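(* Let $\lambda_1,\lambda_2,\lambda_3,\lambda_4\in\mathbb{R}$ and let $G$ be a connected $4$-dimensional Lie group with a global basis $\{X_1,X_2,X_3,X_4\}$ of left invariant vector fields satisfying \[ \begin{aligned} [X_1,X_2]&=\lambda_2X_3-\lambda_1X_4, & [X_2,X_3]&=-\lambda_2X_1-\lambda_3X_4,\\ [X_1,X_3]&=\lambda_2X_2+\lambda_4X_4, & [X_2,X_4]&=\lambda_1X_1+\lambda_3X_3,\\ [X_1,X_4]&=-\lambda_1X_2-\lambda_4X_3, & [X_3,X_4]&=-\lambda_4X_1+\lambda_3X_2 . \end{aligned} \] Let $g$ be the left invariant pseudo-Riemannian metric with $g(X_1,X_1)=g(X_2,X_2)=-g(X_3,X_3)=-g(X_4,X_4)=1$, $g(X_i,X_j)=0$ for $i\ne j$, and let $P$ be the left invariant almost product structure with $PX_1=X_1$, $PX_2=X_2$, $PX_3=-X_3$, $PX_4=-X_4$. Then: (i) $(G,P,g)$ is a locally symmetric ($\nabla R=0$) conformally flat $\mathcal{W}_3$-manifold, and $g$ is a Killing metric. (ii) The components $F_{ijk}=F(X_i,X_j,X_k)$, $R_{ijks}=R(X_i,X_j,X_k,X_s)$, $\rho_{ij}=\rho(X_i,X_j)$ are as follows, all components not listed and not obtained from the listed ones by the symmetries $F_{ijk}=F_{ikj}$, $R_{ijks}=R_{ksij}$, $R_{ijks}=-R_{jiks}=-R_{ijsk}$, $\rho_{ij}=\rho_{ji}$ being zero: \[ F_{124}=-F_{214}=\lambda_1,\quad F_{213}=-F_{123}=\lambda_2,\quad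 F_{423}=-F_{324}=\lambda_3,\quad F_{314}=-F_{413}=\lambda_4; \] \[ \begin{aligned} &R_{1221}=-\tfrac14(\lambda_1^2+\lambda_2^2),\quad R_{1331}=\tfrac14(\lambda_2^2-\lambda_4^2),\quad R_{1441}=\tfrac14(\lambda_1^2-\lambda_4^2),\\ &R_{2332}=\tfrac14(\lambda_2^2-\lambda_3^2),\quad R_{2442}=\tfrac14(\lambda_1^2-\lambda_3^2),\quad R_{3443}=\tfrac14(\lambda_3^2+\lambda_4^2),\\ &R_{1341}=R_{2342}=-\tfrac14\lambda_1\lambda_2,\quad R_{2132}=-R_{4134}=\tfrac14\lambda_1\lambda_3,\quad R_{1231}=-R_{4234}=\tfrac14\lambda_1\lambda_4,\\ &R_{2142}=-R_{3143}=\tfrac14\lambda_2\lambda_3,\quad R_{1241}=-R_{3243}=\tfrac14\lambda_2\lambda_4,\quad R_{3123}=R_{4124}=\tfrac14\lambda_3\lambda_4; \end{aligned} \] \[ \begin{aligned} &\rho_{11}=-\tfrac12(\lambda_1^2+\lambda_2^2-\lambda_4^2),\quad \rho_{22}=-\tfrac12(\lambda_1^2+\lambda_2^2-\lambda_3^2),\\ &\rho_{33}=\tfrac12(\lambda_2^2-\lambda_3^2-\lambda_4^2),\quad \rho_{44}=\tfrac12(\lambda_1^2-\lambda_3^2-\lambda_4^2),\\ &\rho_{12}=-\tfrac12\lambda_3\lambda_4,\quad \rho_{13}=\tfrac12\lambda_1\lambda_3,\quad \rho_{14}=\tfrac12\lambda_2\lambda_3,\\ &\rho_{23}=\tfrac12\lambda_1\lambda_4,\quad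 \rho_{24}=\tfrac12\lambda_2\lambda_4,\quad \rho_{34}=-\tfrac12\lambda_1\lambda_2 . \end{aligned} \] (iii) $\|N\|^2=24(\lambda_1^2+\lambda_2^2-\lambda_3^2-\lambda_4^2)$ and $\|\nabla P\|^2=-4(\lambda_1^2+\lambda_2^2-\lambda_3^2-\lambda_4^2)$. (iv) The scalar curvature is $\tau=-\tfrac32(\lambda_1^2+\lambda_2^2-\lambda_3^2-\lambda_4^2)$, and the sectional curvatures $k_{ij}$ of the basic $2$-planes $\alpha_{ij}=\mathrm{span}(X_i,X_j)$ are \[ \begin{aligned} &k_{13}=-\tfrac14(\lambda_2^2-\lambda_4^2),\quad k_{24}=-\tfrac14(\lambda_1^2-\lambda_3^2),\quad k_{12}=-\tfrac14(\lambda_1^2+\lambda_2^2),\\ &k_{14}=-\tfrac14(\lambda_1^2-\lambda_4^2),\quad k_{23}=-\tfrac14(\lambda_2^2-\lambda_3^2),\quad k_{34}=\tfrac14(\lambda_3^2+\lambda_4^2). \end{aligned} \]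
   Context: An almost product structure is a $(1,1)$-tensor field $P$ with $P^2=\mathrm{id}$. Let $\nabla$ be the Levi-Civita connection of $g$. Conventions: - $F(x,y,z)=g((\nabla_xP)y,z)$; $\mathcal{W}_3$-manifold means $F(x,y,z)+F(y,z,x)+F(z,x,y)=0$ for all $x,y,z$. - A left invariant metric $g$ is Killing if $g([X,Y],Z)+g([X,Z],Y)=0$ for all left invariant vector fields $X,Y,Z$. - $R(x,y)z=\nabla_x\nabla_yz-\nabla_y\nabla_xz-\nabla_{[x,y]}z$ and $R(x,y,z,w)=g(R(x,y)z,w)$. - $\rho(y,z)=g^{ij}R(e_i,y,z,e_j)$, $\tau=g^{ij}\rho(e_i,e_j)$, for any basis $\{e_i\}$ of the tangent space, $(g^{ij})$ being the inverse matrix of $(g(e_i,e_j))$. - $\pi_1(x,y,z,w)=g(y,z)g(x,w)-g(x,z)g(y,w)$; the sectional curvature of the nondegenerate plane spanned by $x,y$ is $R(x,y,y,x)/\pi_1(x,y,y,x)$. - Conformally flat (in dimension $4$) is equivalent to vanishing of the Weyl tensor $W=R-\frac12\left(\psi_1(\rho)-\frac{\tau}{3}\pi_1\right)$, where $\psi_1(\rho)(x,y,z,w)=g(y,z)\rho(x,w)-g(x,z)\rho(y,w)+\rho(y,z)g(x,w)-\rho(x,z)g(y,w)$. - $N$ is what is called the Nijenhuis tensor, with components in the basis $\{X_i\}$ given by $N_{ij}=[X_i,X_j]+P[PX_i,X_j]+P[X_i,PX_j]-[PX_i,PX_j]$; its square norm is $\|N\|^2=g^{ij}g^{ks}N_{ik}N_{js}$,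 where the product of the vectors $N_{ik}$, $N_{js}$ is $g(N_{ik},N_{js})$ and $(g^{ij})$ is the inverse matrix of $(g(X_i,X_j))$. - $\|\nabla P\|^2=g^{ij}g^{ks}g((\nabla_{e_i}P)e_k,(\nabla_{e_j}P)e_s)$.
   Formalization: In (iii) the square norm of N is proved to be −24(λ₁²+λ₂²−λ₃²−λ₄²), not 24(…): with the stated conventions λ₁=1, λ₂=λ₃=λ₄=0 gives ‖N‖²=−24, so the printed sign is wrong. *)

theory Defs
  imports "HOL-Analysis.Analysis" "HOL-Library.Function_Algebras"
begin

text \<open>
  Pointwise real vector space structure on functions (the additive structure comes from
  Function_Algebras).  Tangent vectors and vector fields are functions below, so
  \<open>linear combination\<close>, \<open>independent\<close> and \<open>span\<close> are the library notions.
\<close>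

instantiation "fun" :: (type, real_vector) real_vector
begin

definition scaleR_fun :: "real \<Rightarrow> ('a \<Rightarrow> 'b) \<Rightarrow> 'a \<Rightarrow> 'b"
  where "scaleR_fun c f = (\<lambda>x. c *\<^sub>R f x)"

instance
  by standard (simp_all add: scaleR_fun_def plus_fun_def fun_eq_iff scaleR_add_right scaleR_add_left)

end


subsection \<open>Smooth manifolds and Lie groups\<close>

text \<open>\<open>S\<close> is meant to be open: only the values of \<open>f\<close> on \<open>S\<close> matter then.\<close>

primrec Ck_on :: "nat \<Rightarrow> 'a::euclidean_space set \<Rightarrow> ('a \<Rightarrow> 'b::real_normed_vector) \<Rightarrow> bool" where
  "Ck_on 0 S f \<longleftrightarrow> continuous_on S f"
| "Ck_on (Suc k) S f \<longleftrightarrow>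
     (\<forall>x\<in>S. f differentiable (at x)) \<and> (\<forall>v. Ck_on k S (\<lambda>x. frechet_derivative f (at x) v))"

definition smooth_on :: "'a::euclidean_space set \<Rightarrow> ('a \<Rightarrow> 'b::real_normed_vector) \<Rightarrow> bool"
  where "smooth_on S f \<longleftrightarrow> (\<forall>k. Ck_on k S f)"

text \<open>
  A chart is a pair \<open>(U, \<phi>)\<close>, where \<open>\<phi>\<close> is only relevant on \<open>U\<close>.  The underlying
  set of the manifold is the whole type.
\<close>

type_synonym ('m, 'e) atlas = "('m set \<times> ('m \<Rightarrow> 'e)) set"

definition smooth_atlas :: "('m::topological_space, 'e::euclidean_space) atlas \<Rightarrow> bool" where
  "smooth_atlas A \<longleftrightarrow>
     (\<forall>(U, \<phi>)\<in>A. open U \<and> open (\<phi> ` U) \<and> homeomorphism U (\<phi> ` U) \<phi> (inv_into U \<phi>)) \<and>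
     (\<Union>(U, \<phi>)\<in>A. U) = UNIV \<and>
     (\<forall>(U, \<phi>)\<in>A. \<forall>(V, \<psi>)\<in>A. smooth_on (\<phi> ` (U \<inter> V)) (\<psi> \<circ> inv_into U \<phi>))"

definition prod_atlas ::
    "('m, 'e) atlas \<Rightarrow> ('n, 'f) atlas \<Rightarrow> ('m \<times> 'n, 'e \<times> 'f) atlas" where
  "prod_atlas A B = {(U \<times> V, map_prod \<phi> \<psi>) | U \<phi> V \<psi>. (U, \<phi>) \<in> A \<and> (V, \<psi>) \<in> B}"

definition smooth_map ::
    "('m::topological_space, 'e::euclidean_space) atlas \<Rightarrow>
     ('n::topological_space, 'f::euclidean_space) atlas \<Rightarrow> ('m \<Rightarrow> 'n) \<Rightarrow> bool" where
  "smooth_map A B h \<longleftrightarrow> continuous_on UNIV h \<and>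
     (\<forall>(U, \<phi>)\<in>A. \<forall>(V, \<psi>)\<in>B. smooth_on (\<phi> ` (U \<inter> h -` V)) (\<psi> \<circ> h \<circ> inv_into U \<phi>))"

definition smooth_fun :: "('m, 'e::euclidean_space) atlas \<Rightarrow> ('m \<Rightarrow> real) \<Rightarrow> bool"
  where "smooth_fun A f \<longleftrightarrow> (\<forall>(U, \<phi>)\<in>A. smooth_on (\<phi> ` U) (f \<circ> inv_into U \<phi>))"

text \<open>Here \<open>group\<close> is the locale of HOL.Groups: a group whose carrier is the whole type.\<close>

definition lie_group ::
    "('m::{t2_space,second_countable_topology}, 'e::euclidean_space) atlas \<Rightarrow>
     ('m \<Rightarrow> 'm \<Rightarrow> 'm) \<Rightarrow> 'm \<Rightarrow> ('m \<Rightarrow> 'm) \<Rightarrow> bool" where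
  "lie_group A mul e iv \<longleftrightarrow> smooth_atlas A \<and> group mul e iv \<and>
     smooth_map (prod_atlas A A) A (\<lambda>(a, b). mul a b) \<and> smooth_map A A iv"


subsection \<open>Tangent vectors and vector fields\<close>

type_synonym 'm tangent = "('m \<Rightarrow> real) \<Rightarrow> real"
type_synonym 'm vfield = "'m \<Rightarrow> 'm tangent"

text \<open>
  Tangent vectors are derivations at a point of the algebra of smooth functions.  They are
  set to zero on non-smooth functions, so that equality of tangent vectors is equality
  in the type.
\<close>

definition tangent_space :: "('m, 'e::euclidean_space) atlas \<Rightarrow> 'm \<Rightarrow> 'm tangent set" where
  "tangent_space A p = {v.
     (\<forall>a b f h. smooth_fun A f \<longrightarrow> smooth_fun A h \<longrightarrow>
        v (\<lambda>q. a * f q + b * h q) = a * v f + b * v h) \<and>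
     (\<forall>f h. smooth_fun A f \<longrightarrow> smooth_fun A h \<longrightarrow>
        v (\<lambda>q. f q * h q) = v f * h p + f p * v h) \<and>
     (\<forall>f. \<not> smooth_fun A f \<longrightarrow> v f = 0)}"

definition smooth_vf :: "('m, 'e::euclidean_space) atlas \<Rightarrow> 'm vfield \<Rightarrow> bool" where
  "smooth_vf A X \<longleftrightarrow> (\<forall>p. X p \<in> tangent_space A p) \<and>
     (\<forall>f. smooth_fun A f \<longrightarrow> smooth_fun A (\<lambda>p. X p f))"

definition fscale :: "('m \<Rightarrow> real) \<Rightarrow> 'm vfield \<Rightarrow> 'm vfield"
  where "fscale h X = (\<lambda>p. h p *\<^sub>R X p)"

definition bracket :: "'m vfield \<Rightarrow> 'm vfield \<Rightarrow> 'm vfield"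
  where "bracket X Y = (\<lambda>p f. X p (\<lambda>q. Y q f) - Y p (\<lambda>q. X q f))"

definition frame_at :: "('m, 'e::euclidean_space) atlas \<Rightarrow> ('i::finite \<Rightarrow> 'm vfield) \<Rightarrow> 'm \<Rightarrow> bool" where
  "frame_at A E p \<longleftrightarrow> (\<forall>i. smooth_vf A (E i)) \<and>
     inj (\<lambda>i. E i p) \<and> independent (range (\<lambda>i. E i p)) \<and>
     span (range (\<lambda>i. E i p)) = tangent_space A p"

text \<open>The differential of a smooth self-map \<open>h\<close> (at any point).\<close>

definition differential :: "('m, 'e::euclidean_space) atlas \<Rightarrow> ('m \<Rightarrow> 'm) \<Rightarrow> 'm tangent \<Rightarrow> 'm tangent"
  where "differential A h v = (\<lambda>f. if smooth_fun A f then v (f \<circ> h) else 0)"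

definition left_invariant_vf ::
    "('m, 'e::euclidean_space) atlas \<Rightarrow> ('m \<Rightarrow> 'm \<Rightarrow> 'm) \<Rightarrow> 'm vfield \<Rightarrow> bool" where
  "left_invariant_vf A mul X \<longleftrightarrow> smooth_vf A X \<and>
     (\<forall>a p. X (mul a p) = differential A (mul a) (X p))"


subsection \<open>Pseudo-Riemannian metrics and almost product structures\<close>

definition linear_at ::
    "('m, 'e::euclidean_space) atlas \<Rightarrow> 'm \<Rightarrow> ('m tangent \<Rightarrow> 'b::real_vector) \<Rightarrow> bool" where
  "linear_at A p L \<longleftrightarrow> (\<forall>u\<in>tangent_space A p. \<forall>v\<in>tangent_space A p. \<forall>a b.
     L (a *\<^sub>R u + b *\<^sub>R v) = a *\<^sub>R L u + b *\<^sub>R L v)"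

type_synonym 'm metric_field = "'m \<Rightarrow> 'm tangent \<Rightarrow> 'm tangent \<Rightarrow> real"
type_synonym 'm endo_field = "'m \<Rightarrow> 'm tangent \<Rightarrow> 'm tangent"

definition ip :: "'m metric_field \<Rightarrow> 'm vfield \<Rightarrow> 'm vfield \<Rightarrow> 'm \<Rightarrow> real"
  where "ip g X Y = (\<lambda>p. g p (X p) (Y p))"

definition endo :: "'m endo_field \<Rightarrow> 'm vfield \<Rightarrow> 'm vfield"
  where "endo P X = (\<lambda>p. P p (X p))"

text \<open>The signature is not prescribed; it is constant on a connected manifold.\<close>

definition pseudo_riemannian :: "('m, 'e::euclidean_space) atlas \<Rightarrow> 'm metric_field \<Rightarrow> bool" where
  "pseudo_riemannian A g \<longleftrightarrow>
     (\<forall>p. \<forall>u\<in>tangent_space A p. linear_at A p (g p u)) \<and>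
     (\<forall>p. \<forall>u\<in>tangent_space A p. \<forall>v\<in>tangent_space A p. g p u v = g p v u) \<and>
     (\<forall>p. \<forall>u\<in>tangent_space A p. (\<forall>v\<in>tangent_space A p. g p u v = 0) \<longrightarrow> u = 0) \<and>
     (\<forall>X Y. smooth_vf A X \<longrightarrow> smooth_vf A Y \<longrightarrow> smooth_fun A (ip g X Y))"

definition left_invariant_metric ::
    "('m, 'e::euclidean_space) atlas \<Rightarrow> ('m \<Rightarrow> 'm \<Rightarrow> 'm) \<Rightarrow> 'm metric_field \<Rightarrow> bool" where
  "left_invariant_metric A mul g \<longleftrightarrow>
     (\<forall>a p. \<forall>u\<in>tangent_space A p. \<forall>v\<in>tangent_space A p.
        g (mul a p) (differential A (mul a) u) (differential A (mul a) v) = g p u v)"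

definition almost_product :: "('m, 'e::euclidean_space) atlas \<Rightarrow> 'm endo_field \<Rightarrow> bool" where
  "almost_product A P \<longleftrightarrow>
     (\<forall>p. linear_at A p (P p)) \<and>
     (\<forall>p. \<forall>v\<in>tangent_space A p. P p v \<in> tangent_space A p \<and> P p (P p v) = v) \<and>
     (\<forall>X. smooth_vf A X \<longrightarrow> smooth_vf A (endo P X))"

definition left_invariant_endo ::
    "('m, 'e::euclidean_space) atlas \<Rightarrow> ('m \<Rightarrow> 'm \<Rightarrow> 'm) \<Rightarrow> 'm endo_field \<Rightarrow> bool" where
  "left_invariant_endo A mul P \<longleftrightarrow>
     (\<forall>a p. \<forall>v\<in>tangent_space A p.
        P (mul a p) (differential A (mul a) v) = differential A (mul a) (P p v))"

definition killing_metric ::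
    "('m, 'e::euclidean_space) atlas \<Rightarrow> ('m \<Rightarrow> 'm \<Rightarrow> 'm) \<Rightarrow> 'm metric_field \<Rightarrow> bool" where
  "killing_metric A mul g \<longleftrightarrow>
     (\<forall>X Y Z. left_invariant_vf A mul X \<longrightarrow> left_invariant_vf A mul Y \<longrightarrow> left_invariant_vf A mul Z \<longrightarrow>
        (\<forall>p. ip g (bracket X Y) Z p + ip g (bracket X Z) Y p = 0))"


subsection \<open>Levi-Civita connection and curvature\<close>

type_synonym 'm connection = "'m vfield \<Rightarrow> 'm vfield \<Rightarrow> 'm vfield"

definition affine_connection :: "('m, 'e::euclidean_space) atlas \<Rightarrow> 'm connection \<Rightarrow> bool" where
  "affine_connection A D \<longleftrightarrow>
     (\<forall>X Y. smooth_vf A X \<longrightarrow> smooth_vf A Y \<longrightarrow> smooth_vf A (D X Y)) \<and>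
     (\<forall>X Y Z. smooth_vf A X \<longrightarrow> smooth_vf A Y \<longrightarrow> smooth_vf A Z \<longrightarrow>
        D (X + Y) Z = D X Z + D Y Z \<and> D X (Y + Z) = D X Y + D X Z) \<and>
     (\<forall>f X Y. smooth_fun A f \<longrightarrow> smooth_vf A X \<longrightarrow> smooth_vf A Y \<longrightarrow>
        D (fscale f X) Y = fscale f (D X Y) \<and>
        D X (fscale f Y) = fscale (\<lambda>p. X p f) Y + fscale f (D X Y))"

definition levi_civita ::
    "('m, 'e::euclidean_space) atlas \<Rightarrow> 'm metric_field \<Rightarrow> 'm connection \<Rightarrow> bool" where
  "levi_civita A g D \<longleftrightarrow> affine_connection A D \<and>
     (\<forall>X Y. smooth_vf A X \<longrightarrow> smooth_vf A Y \<longrightarrow> D X Y - D Y X = bracket X Y) \<and>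
     (\<forall>X Y Z. smooth_vf A X \<longrightarrow> smooth_vf A Y \<longrightarrow> smooth_vf A Z \<longrightarrow>
        (\<forall>p. X p (ip g Y Z) = ip g (D X Y) Z p + ip g Y (D X Z) p))"

definition nabla_endo :: "'m connection \<Rightarrow> 'm endo_field \<Rightarrow> 'm vfield \<Rightarrow> 'm vfield \<Rightarrow> 'm vfield"
  where "nabla_endo D P X Y = D X (endo P Y) - endo P (D X Y)"

definition F_tensor ::
    "'m metric_field \<Rightarrow> 'm connection \<Rightarrow> 'm endo_field \<Rightarrow> 'm vfield \<Rightarrow> 'm vfield \<Rightarrow> 'm vfield \<Rightarrow> 'm \<Rightarrow> real"
  where "F_tensor g D P X Y Z = ip g (nabla_endo D P X Y) Z"

definition W3_manifold ::
    "('m, 'e::euclidean_space) atlas \<Rightarrow> 'm metric_field \<Rightarrow> 'm connection \<Rightarrow> 'm endo_field \<Rightarrow> bool" where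
  "W3_manifold A g D P \<longleftrightarrow>
     (\<forall>X Y Z. smooth_vf A X \<longrightarrow> smooth_vf A Y \<longrightarrow> smooth_vf A Z \<longrightarrow>
        (\<forall>p. F_tensor g D P X Y Z p + F_tensor g D P Y Z X p + F_tensor g D P Z X Y p = 0))"

definition curv :: "'m connection \<Rightarrow> 'm vfield \<Rightarrow> 'm vfield \<Rightarrow> 'm vfield \<Rightarrow> 'm vfield"
  where "curv D X Y Z = D X (D Y Z) - D Y (D X Z) - D (bracket X Y) Z"

definition Rm ::
    "'m metric_field \<Rightarrow> 'm connection \<Rightarrow> 'm vfield \<Rightarrow> 'm vfield \<Rightarrow> 'm vfield \<Rightarrow> 'm vfield \<Rightarrow> 'm \<Rightarrow> real"
  where "Rm g D X Y Z W = ip g (curv D X Y Z) W"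

definition nabla_curv ::
    "'m connection \<Rightarrow> 'm vfield \<Rightarrow> 'm vfield \<Rightarrow> 'm vfield \<Rightarrow> 'm vfield \<Rightarrow> 'm vfield"
  where "nabla_curv D U X Y Z =
    D U (curv D X Y Z) - curv D (D U X) Y Z - curv D X (D U Y) Z - curv D X Y (D U Z)"

definition locally_symmetric :: "('m, 'e::euclidean_space) atlas \<Rightarrow> 'm connection \<Rightarrow> bool" where
  "locally_symmetric A D \<longleftrightarrow>
     (\<forall>U X Y Z. smooth_vf A U \<longrightarrow> smooth_vf A X \<longrightarrow> smooth_vf A Y \<longrightarrow> smooth_vf A Z \<longrightarrow>
        nabla_curv D U X Y Z = 0)"

text \<open>The matrix \<open>(g\<^sup>i\<^sup>j)\<close> at \<open>p\<close>, inverse to \<open>(g(E i, E j))\<close>.\<close>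

definition ginv :: "'m metric_field \<Rightarrow> ('i::finite \<Rightarrow> 'm vfield) \<Rightarrow> 'm \<Rightarrow> real ^ 'i ^ 'i"
  where "ginv g E p = matrix_inv (\<chi> i j. ip g (E i) (E j) p)"

text \<open>
  Traces at a point \<open>p\<close> are taken with respect to smooth vector fields \<open>E\<close> whose values at
  \<open>p\<close> are a basis of the tangent space, i.e. \<open>frame_at A E p\<close>.  Statements quantify over
  all such \<open>E\<close>.
\<close>

definition ricci ::
    "'m metric_field \<Rightarrow> 'm connection \<Rightarrow> ('i::finite \<Rightarrow> 'm vfield) \<Rightarrow> 'm vfield \<Rightarrow> 'm vfield \<Rightarrow> 'm \<Rightarrow> real"
  where "ricci g D E Y Z p = (\<Sum>i\<in>UNIV. \<Sum>j\<in>UNIV. ginv g E p $ i $ j * Rm g D (E i) Y Z (E j) p)"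

definition scalar_curv ::
    "'m metric_field \<Rightarrow> 'm connection \<Rightarrow> ('i::finite \<Rightarrow> 'm vfield) \<Rightarrow> 'm \<Rightarrow> real"
  where "scalar_curv g D E p =
    (\<Sum>i\<in>UNIV. \<Sum>j\<in>UNIV. ginv g E p $ i $ j * ricci g D E (E i) (E j) p)"

definition pi1 ::
    "'m metric_field \<Rightarrow> 'm vfield \<Rightarrow> 'm vfield \<Rightarrow> 'm vfield \<Rightarrow> 'm vfield \<Rightarrow> 'm \<Rightarrow> real"
  where "pi1 g X Y Z W p = ip g Y Z p * ip g X W p - ip g X Z p * ip g Y W p"

definition sectional_curv ::
    "'m metric_field \<Rightarrow> 'm connection \<Rightarrow> 'm vfield \<Rightarrow> 'm vfield \<Rightarrow> 'm \<Rightarrow> real"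
  where "sectional_curv g D X Y p = Rm g D X Y Y X p / pi1 g X Y Y X p"

definition psi1_ricci ::
    "'m metric_field \<Rightarrow> 'm connection \<Rightarrow> ('i::finite \<Rightarrow> 'm vfield) \<Rightarrow>
     'm vfield \<Rightarrow> 'm vfield \<Rightarrow> 'm vfield \<Rightarrow> 'm vfield \<Rightarrow> 'm \<Rightarrow> real"
  where "psi1_ricci g D E X Y Z W p =
    ip g Y Z p * ricci g D E X W p - ip g X Z p * ricci g D E Y W p +
    ricci g D E Y Z p * ip g X W p - ricci g D E X Z p * ip g Y W p"

text \<open>The coefficients are those of dimension 4, whence the index type.\<close>

definition weyl4 ::
    "'m metric_field \<Rightarrow> 'm connection \<Rightarrow> (4 \<Rightarrow> 'm vfield) \<Rightarrow>
     'm vfield \<Rightarrow> 'm vfield \<Rightarrow> 'm vfield \<Rightarrow> 'm vfield \<Rightarrow> 'm \<Rightarrow> real"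
  where "weyl4 g D E X Y Z W p = Rm g D X Y Z W p -
    1/2 * (psi1_ricci g D E X Y Z W p - scalar_curv g D E p / 3 * pi1 g X Y Z W p)"

text \<open>In dimension 4 conformal flatness means the vanishing of the Weyl tensor.\<close>

definition conformally_flat4 ::
    "('m, real^4) atlas \<Rightarrow> 'm metric_field \<Rightarrow> 'm connection \<Rightarrow> bool" where
  "conformally_flat4 A g D \<longleftrightarrow>
     (\<forall>p E. frame_at A E p \<longrightarrow>
       (\<forall>X Y Z W. smooth_vf A X \<longrightarrow> smooth_vf A Y \<longrightarrow> smooth_vf A Z \<longrightarrow> smooth_vf A W \<longrightarrow>
          weyl4 g D E X Y Z W p = 0))"

text \<open>
  The signs in \<open>nijenhuis\<close> are not those of the classical Nijenhuis tensor, and the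
  expression is not tensorial; it is only to be used on a fixed left invariant basis.
  With these signs its square norm for the metric \<open>g\<close> of signature (2,2) considered here is
  \<open>-24 * (l1^2 + l2^2 - l3^2 - l4^2)\<close>: already for \<open>l1 = 1\<close>, \<open>l2 = l3 = l4 = 0\<close>
  the products \<open>(g X\<^sub>i X\<^sub>i) (g X\<^sub>j X\<^sub>j) (g N\<^sub>i\<^sub>j N\<^sub>i\<^sub>j)\<close>
  for (i,j) = (1,2), (1,4), (2,4) are all -4, and the other pairs i < j give 0.  The source prints
  this value with the opposite sign.
\<close>

definition nijenhuis :: "'m endo_field \<Rightarrow> 'm vfield \<Rightarrow> 'm vfield \<Rightarrow> 'm vfield"
  where "nijenhuis P X Y =
    bracket X Y + endo P (bracket (endo P X) Y) + endo P (bracket X (endo P Y))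
      - bracket (endo P X) (endo P Y)"

definition nijenhuis_sqnorm ::
    "'m metric_field \<Rightarrow> 'm endo_field \<Rightarrow> ('i::finite \<Rightarrow> 'm vfield) \<Rightarrow> 'm \<Rightarrow> real"
  where "nijenhuis_sqnorm g P E p =
    (\<Sum>i\<in>UNIV. \<Sum>j\<in>UNIV. \<Sum>k\<in>UNIV. \<Sum>s\<in>UNIV. ginv g E p $ i $ j * ginv g E p $ k $ s *
        ip g (nijenhuis P (E i) (E k)) (nijenhuis P (E j) (E s)) p)"

definition nablaP_sqnorm ::
    "'m metric_field \<Rightarrow> 'm connection \<Rightarrow> 'm endo_field \<Rightarrow> ('i::finite \<Rightarrow> 'm vfield) \<Rightarrow> 'm \<Rightarrow> real"
  where "nablaP_sqnorm g D P E p =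
    (\<Sum>i\<in>UNIV. \<Sum>j\<in>UNIV. \<Sum>k\<in>UNIV. \<Sum>s\<in>UNIV. ginv g E p $ i $ j * ginv g E p $ k $ s *
        ip g (nabla_endo D P (E i) (E k)) (nabla_endo D P (E j) (E s)) p)"


subsection \<open>Index sets closed under the symmetries of components\<close>

inductive_set F_closure :: "('i \<times> 'i \<times> 'i) set \<Rightarrow> ('i \<times> 'i \<times> 'i) set"
  for L :: "('i \<times> 'i \<times> 'i) set" where
  "(i, j, k) \<in> L \<Longrightarrow> (i, j, k) \<in> F_closure L"
| "(i, j, k) \<in> F_closure L \<Longrightarrow> (i, k, j) \<in> F_closure L"

inductive_set R_closure :: "('i \<times> 'i \<times> 'i \<times> 'i) set \<Rightarrow> ('i \<times> 'i \<times> 'i \<times> 'i) set"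
  for L :: "('i \<times> 'i \<times> 'i \<times> 'i) set" where
  "(i, j, k, s) \<in> L \<Longrightarrow> (i, j, k, s) \<in> R_closure L"
| "(i, j, k, s) \<in> R_closure L \<Longrightarrow> (k, s, i, j) \<in> R_closure L"
| "(i, j, k, s) \<in> R_closure L \<Longrightarrow> (j, i, k, s) \<in> R_closure L"
| "(i, j, k, s) \<in> R_closure L \<Longrightarrow> (i, j, s, k) \<in> R_closure L"

end

theory Submission
  imports Defs
begin

text \<open>
  The brackets are \<open>g([x, y], z) = \<theta>(x, y, z)\<close> for a constant 3-form \<open>\<theta>\<close>, so \<open>ad\<close> is skew for \<open>g\<close>
  and the Koszul formula gives \<open>\<nabla>\<^sub>x y = [x, y] / 2\<close> for left invariant fields.  With the Jacobi identity,
  \<open>R(x, y) z = - [[x, y], z] / 4\<close>, and \<open>\<nabla>R = 0\<close> because \<open>ad\<close> acts by derivations.  All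
  remaining claims are polynomial identities in the structure constants.  They extend from the frame to
  arbitrary fields by tensoriality, without cut-off functions: the frame is global and the coefficients
  of a smooth field in it are smooth.
\<close>

subsection \<open>Smooth functions\<close>

text \<open>On the frame every claim is a finite computation; the work lies in the quantifiers. They
  range over all smooth fields and, for traces, over all families \<open>E\<close> that need to be a
  basis at the single point \<open>p\<close> only. Hence linearity over functions is turned into a
  notion of tensoriality at \<open>p\<close>, and traces pass from \<open>E\<close> to
  \<open>X\<close> through the coefficient matrix at \<open>p\<close>. The expression
  \<open>nijenhuis\<close> is not tensorial and is evaluated on \<open>X\<close> alone. The
  constants have a common source: \<theta> is the contraction of the volume form of the frame with
  \<open>v = l3 X1 + l4 X2 + l1 X3 + l2 X4\<close>. This \<open>v\<close> is central, and
  \<open>g(v, v) = -(l1^2 + l2^2 - l3^2 - l4^2)\<close>. The curvature depends on \<open>g\<close>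
  and \<open>v\<close> only, in a form without Weyl part, and the scalar curvature and both square
  norms are multiples of \<open>g(v, v)\<close>.\<close>

lemma Ck_on_cong:
  assumes "open S" "\<And>x. x \<in> S \<Longrightarrow> f x = h x" "Ck_on k S f"
  shows "Ck_on k S h"
  using assms(2,3)
proof (induction k arbitrary: f h)
  case 0
  then show ?case using continuous_on_cong[of S S f h] by simp
next
  case (Suc k)
  have ev: "eventually (\<lambda>y. f y = h y) (nhds x)" if "x \<in> S" for x
    using assms(1) that Suc.prems(1) eventually_nhds by blast
  have der: "(h has_derivative f') (at x) \<longleftrightarrow> (f has_derivative f') (at x)" if "x \<in> S" for x f'
    using has_derivative_transform_within_open[OF _ assms(1) that, of f f' UNIV h]
      has_derivative_transform_within_open[OF _ assms(1) that, of h f' UNIV f] Suc.prems(1) that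
    by metis
  \<comment> \<open>Both functions have the same derivatives at \<open>x\<close>, so the choice
    hidden in \<open>frechet_derivative\<close> is made from the same predicate.\<close>
  have fd: "frechet_derivative f (at x) = frechet_derivative h (at x)" if "x \<in> S" for x
    unfolding frechet_derivative_def using der[OF that] by simp
  have "Ck_on k S (\<lambda>x. frechet_derivative h (at x) v)" for v
    by (rule Suc.IH[of "\<lambda>x. frechet_derivative f (at x) v"]) (use fd Suc.prems(2) in auto)
  moreover have "h differentiable at x" if "x \<in> S" for x
    using Suc.prems(2) that der[OF that] by (simp add: differentiable_def)
  ultimately show ?case by simp
qed

lemma Ck_on_const: "Ck_on k S (\<lambda>x. c)"
  by (induction k arbitrary: c) auto

text \<open>The product rule pairs the derivative of one factor with the other factor itself; this
  brings the latter down to the order of the former.\<close>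

lemma Ck_on_SucD: "Ck_on (Suc k) S f \<Longrightarrow> Ck_on k S f"
proof (induction k arbitrary: f)
  case 0
  then show ?case
    by (auto intro!: continuous_at_imp_continuous_on differentiable_imp_continuous_within)
next
  case (Suc k)
  then show ?case by (metis Ck_on.simps(2))
qed

lemma Ck_on_add:
  assumes "open S" "Ck_on k S f" "Ck_on k S h"
  shows "Ck_on k S (\<lambda>x. f x + h x)"
  using assms(2,3)
proof (induction k arbitrary: f h)
  case 0
  then show ?case by (auto intro: continuous_intros)
next
  case (Suc k)
  have "Ck_on k S (\<lambda>x. frechet_derivative (\<lambda>x. f x + h x) (at x) v)" for v
  proof (rule Ck_on_cong[OF assms(1) _ Suc.IH])
    fix x assume "x \<in> S"
    then show "frechet_derivative f (at x) v + frechet_derivative h (at x) v =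
        frechet_derivative (\<lambda>x. f x + h x) (at x) v"
      using Suc.prems by (intro fun_cong[OF frechet_derivative_at] has_derivative_add)
        (auto simp: frechet_derivative_works)
  qed (use Suc.prems in auto)
  with Suc.prems show ?case by (auto intro!: differentiable_add)
qed

lemma Ck_on_mult:
  fixes f h :: "'a::euclidean_space \<Rightarrow> 'b::real_normed_algebra"
  assumes "open S" "Ck_on k S f" "Ck_on k S h"
  shows "Ck_on k S (\<lambda>x. f x * h x)"
  using assms(2,3)
proof (induction k arbitrary: f h)
  case 0
  then show ?case by (auto intro: continuous_intros)
next
  case (Suc k)
  have "Ck_on k S (\<lambda>x. frechet_derivative (\<lambda>x. f x * h x) (at x) v)" for v
  proof (rule Ck_on_cong[OF assms(1) _ Ck_on_add[OF assms(1) Suc.IH Suc.IH]])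
    fix x assume "x \<in> S"
    then show "f x * frechet_derivative h (at x) v + frechet_derivative f (at x) v * h x =
        frechet_derivative (\<lambda>x. f x * h x) (at x) v"
      using Suc.prems by (intro fun_cong[OF frechet_derivative_at] has_derivative_mult)
        (auto simp: frechet_derivative_works)
  qed (use Suc.prems Ck_on_SucD in auto)
  with Suc.prems show ?case by (auto intro!: differentiable_mult)
qed

lemma smooth_atlas_open: "smooth_atlas A \<Longrightarrow> (U, \<phi>) \<in> A \<Longrightarrow> open (\<phi> ` U)"
  by (auto simp: smooth_atlas_def)

lemma smooth_fun_const: "smooth_fun A (\<lambda>p. c)"
  by (auto simp: smooth_fun_def smooth_on_def comp_def Ck_on_const)

lemma smooth_fun_add:
  assumes "smooth_atlas A" "smooth_fun A f" "smooth_fun A h"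
  shows "smooth_fun A (\<lambda>p. f p + h p)"
  using assms(2,3) unfolding smooth_fun_def smooth_on_def comp_def
  by (fast intro: Ck_on_add dest: smooth_atlas_open[OF assms(1)])

lemma smooth_fun_mult:
  assumes "smooth_atlas A" "smooth_fun A f" "smooth_fun A h"
  shows "smooth_fun A (\<lambda>p. f p * h p)"
  using assms(2,3) unfolding smooth_fun_def smooth_on_def comp_def
  by (fast intro: Ck_on_mult dest: smooth_atlas_open[OF assms(1)])

lemma smooth_fun_cmult:
  assumes "smooth_atlas A" "smooth_fun A f"
  shows "smooth_fun A (\<lambda>p. c * f p)"
  using smooth_fun_mult[OF assms(1) smooth_fun_const assms(2)] .

subsection \<open>Tangent vectors and vector fields\<close>

lemma scaleR_fun_apply [simp]: "(c *\<^sub>R f) x = c *\<^sub>R f x"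
  by (simp add: scaleR_fun_def)

lemma sum_fun_apply: "(\<Sum>i\<in>I. f i) x = (\<Sum>i\<in>I. f i x)"
  by (induction I rule: infinite_finite_induct) auto

lemma fscale_apply [simp]: "fscale h X p = h p *\<^sub>R X p"
  by (simp add: fscale_def)

lemma fscale_const: "fscale (\<lambda>p. c) X = c *\<^sub>R X"
  by (simp add: fun_eq_iff)

lemma tangent_lincomb:
  assumes "v \<in> tangent_space A p" "smooth_fun A f" "smooth_fun A h"
  shows "v (\<lambda>q. a * f q + b * h q) = a * v f + b * v h"
  using assms by (auto simp: tangent_space_def)

lemma tangent_mult:
  assumes "v \<in> tangent_space A p" "smooth_fun A f" "smooth_fun A h"
  shows "v (\<lambda>q. f q * h q) = v f * h p + f p * v h"
  using assms by (auto simp: tangent_space_def)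

lemma tangent_not_smooth: "v \<in> tangent_space A p \<Longrightarrow> \<not> smooth_fun A f \<Longrightarrow> v f = 0"
  by (auto simp: tangent_space_def)

lemma tangent_const:
  assumes "v \<in> tangent_space A p"
  shows "v (\<lambda>q. c) = 0"
proof -
  have "v (\<lambda>q. 1) = 0"
    using tangent_mult[OF assms smooth_fun_const smooth_fun_const, of 1 1] by simp
  then show ?thesis
    using tangent_lincomb[OF assms smooth_fun_const smooth_fun_const, of c 1 0 0] by simp
qed

lemma tangent_diff:
  assumes "v \<in> tangent_space A p" "smooth_fun A f" "smooth_fun A h"
  shows "v (\<lambda>q. f q - h q) = v f - v h"
  using tangent_lincomb[OF assms, of 1 "-1"] by simp

lemma subspace_tangent_space: "subspace (tangent_space A p)"
  by (rule subspaceI) (simp_all add: tangent_space_def algebra_simps)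

lemma linear_at_sum:
  assumes "linear_at A p L" "\<And>i. i \<in> I \<Longrightarrow> v i \<in> tangent_space A p"
  shows "L (\<Sum>i\<in>I. c i *\<^sub>R v i) = (\<Sum>i\<in>I. c i *\<^sub>R L (v i))"
  using assms(2)
proof (induction I rule: infinite_finite_induct)
  case (insert i I)
  have "(\<Sum>i\<in>I. c i *\<^sub>R v i) \<in> tangent_space A p"
    using insert.prems subspace_tangent_space
    by (intro subspace_sum subspace_scale) auto
  then have "L (c i *\<^sub>R v i + 1 *\<^sub>R (\<Sum>i\<in>I. c i *\<^sub>R v i)) =
      c i *\<^sub>R L (v i) + 1 *\<^sub>R L (\<Sum>i\<in>I. c i *\<^sub>R v i)"
    using assms(1) insert.prems by (auto simp only: linear_at_def)
  with insert.IH insert.prems show ?case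
    by (simp only: sum.insert[OF insert.hyps] scaleR_one insert_iff simp_thms)
next
  \<comment> \<open>A sum over an infinite index set is 0 by convention, so both remaining cases ask
    for this value only.\<close>
  have "L 0 = 0"
    using assms(1)[unfolded linear_at_def, rule_format, of 0 0 0 0]
      subspace_0[OF subspace_tangent_space, of A p] by simp
  {
    case (infinite I)
    show ?case using \<open>L 0 = 0\<close> by (simp only: sum.infinite[OF infinite.hyps] sum.empty)
  next
    case empty
    show ?case using \<open>L 0 = 0\<close> by (simp only: sum.empty)
  }
qed

lemma smooth_vf_at: "smooth_vf A X \<Longrightarrow> X p \<in> tangent_space A p"
  by (simp add: smooth_vf_def)

lemma smooth_vf_deriv: "smooth_vf A X \<Longrightarrow> smooth_fun A f \<Longrightarrow> smooth_fun A (\<lambda>p. X p f)"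
  by (simp add: smooth_vf_def)

lemma smooth_vfI:
  assumes "\<And>p. X p \<in> tangent_space A p" "\<And>f. smooth_fun A f \<Longrightarrow> smooth_fun A (\<lambda>p. X p f)"
  shows "smooth_vf A X"
  using assms by (simp add: smooth_vf_def)

lemma smooth_vf_add:
  assumes "smooth_atlas A" "smooth_vf A X" "smooth_vf A Y"
  shows "smooth_vf A (X + Y)"
proof (rule smooth_vfI)
  show "(X + Y) p \<in> tangent_space A p" for p
    by (subst plus_fun_apply)
      (intro subspace_add[OF subspace_tangent_space] smooth_vf_at assms)
qed (use assms in \<open>simp add: smooth_fun_add smooth_vf_deriv\<close>)

lemma smooth_vf_fscale:
  assumes "smooth_atlas A" "smooth_fun A f" "smooth_vf A X"
  shows "smooth_vf A (fscale f X)"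
proof (rule smooth_vfI)
  show "fscale f X p \<in> tangent_space A p" for p
    by (subst fscale_apply)
      (intro subspace_scale[OF subspace_tangent_space] smooth_vf_at assms)
qed (use assms in \<open>simp add: smooth_fun_mult smooth_vf_deriv\<close>)

lemma smooth_vf_scaleR:
  assumes "smooth_atlas A" "smooth_vf A X"
  shows "smooth_vf A (c *\<^sub>R X)"
  using smooth_vf_fscale[OF assms(1) smooth_fun_const assms(2)] by (simp add: fscale_const)

lemma smooth_vf_zero: "smooth_vf A 0"
  using subspace_0[OF subspace_tangent_space] by (auto simp: smooth_vf_def smooth_fun_const)

lemma smooth_vf_diff:
  assumes "smooth_atlas A" "smooth_vf A X" "smooth_vf A Y"
  shows "smooth_vf A (X - Y)"
  using smooth_vf_add[OF assms(1,2) smooth_vf_scaleR[OF assms(1,3), of "-1"]] by simp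

lemma subspace_smooth_vf: "smooth_atlas A \<Longrightarrow> subspace (Collect (smooth_vf A))"
  by (rule subspaceI) (auto simp: smooth_vf_zero smooth_vf_add smooth_vf_scaleR)

lemma bracket_swap: "bracket X Y = - bracket Y X"
  by (simp add: bracket_def fun_eq_iff)

lemma smooth_vf_apply_not_smooth: "smooth_vf A X \<Longrightarrow> \<not> smooth_fun A f \<Longrightarrow> X p f = 0"
  using smooth_vf_at tangent_not_smooth by metis

text \<open>If \<open>f\<close> is smooth, so are its derivatives along \<open>Y\<close> and
  \<open>Z\<close>, and \<open>X p\<close> distributes over their combination. If not, those
  derivatives are the zero function by the convention on tangent vectors, and
  \<open>tangent_const\<close> kills them.\<close>

lemma bracket_lincomb_right:
  assumes "smooth_atlas A" "smooth_vf A X" "smooth_vf A Y" "smooth_vf A Z"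
  shows "bracket X (a *\<^sub>R Y + b *\<^sub>R Z) = a *\<^sub>R bracket X Y + b *\<^sub>R bracket X Z"
proof (intro ext)
  fix p f
  show "bracket X (a *\<^sub>R Y + b *\<^sub>R Z) p f = (a *\<^sub>R bracket X Y + b *\<^sub>R bracket X Z) p f"
  proof (cases "smooth_fun A f")
    case True
    then have "X p (\<lambda>q. a * Y q f + b * Z q f) = a * X p (\<lambda>q. Y q f) + b * X p (\<lambda>q. Z q f)"
      using tangent_lincomb[OF smooth_vf_at[OF assms(2)]
          smooth_vf_deriv[OF assms(3)] smooth_vf_deriv[OF assms(4)]] by blast
    then show ?thesis by (simp add: bracket_def algebra_simps)
  next
    case False
    note z = assms(2-4)[THEN smooth_vf_apply_not_smooth, OF False]
      assms(2-4)[THEN smooth_vf_at, THEN tangent_const]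
    show ?thesis by (simp add: bracket_def z)
  qed
qed

lemma bracket_scaleR_right:
  assumes "smooth_atlas A" "smooth_vf A X" "smooth_vf A Y"
  shows "bracket X (a *\<^sub>R Y) = a *\<^sub>R bracket X Y"
  using bracket_lincomb_right[OF assms assms(3), of a 0] by simp

lemma bracket_add_right:
  assumes "smooth_atlas A" "smooth_vf A X" "smooth_vf A Y" "smooth_vf A Z"
  shows "bracket X (Y + Z) = bracket X Y + bracket X Z"
  using bracket_lincomb_right[OF assms, of 1 1] by simp

lemma bracket_scaleR_left:
  assumes "smooth_atlas A" "smooth_vf A X" "smooth_vf A Y"
  shows "bracket (a *\<^sub>R X) Y = a *\<^sub>R bracket X Y"
  using bracket_scaleR_right[OF assms(1,3,2), of a] bracket_swap[of _ Y] by simp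

lemma bracket_add_left:
  assumes "smooth_atlas A" "smooth_vf A X" "smooth_vf A Y" "smooth_vf A Z"
  shows "bracket (X + Y) Z = bracket X Z + bracket Y Z"
  using bracket_add_right[OF assms(1,4,2,3)] bracket_swap[of _ Z] by simp

text \<open>For commutators of derivations the triple compositions cancel. This is the only source
  of the Jacobi identity; it is never tested on the structure constants.\<close>

lemma bracket_jacobi:
  assumes "smooth_atlas A" "smooth_vf A X" "smooth_vf A Y" "smooth_vf A Z"
  shows "bracket X (bracket Y Z) = bracket (bracket X Y) Z + bracket Y (bracket X Z)"
proof (intro ext)
  fix p f
  show "bracket X (bracket Y Z) p f = (bracket (bracket X Y) Z + bracket Y (bracket X Z)) p f"
  proof (cases "smooth_fun A f")
    case True
    have d: "U p (\<lambda>q. V q (\<lambda>r. W r f) - W q (\<lambda>r. V r f)) =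
        U p (\<lambda>q. V q (\<lambda>r. W r f)) - U p (\<lambda>q. W q (\<lambda>r. V r f))"
      if "smooth_vf A U" "smooth_vf A V" "smooth_vf A W" for U V W
      using tangent_diff[OF smooth_vf_at[OF that(1)]
          smooth_vf_deriv[OF that(2) smooth_vf_deriv[OF that(3) True]]
          smooth_vf_deriv[OF that(3) smooth_vf_deriv[OF that(2) True]]] .
    show ?thesis
      using assms(2-) by (simp add: bracket_def d)
  next
    case False
    note z = assms(2-4)[THEN smooth_vf_apply_not_smooth, OF False]
      assms(2-4)[THEN smooth_vf_at, THEN tangent_const]
    show ?thesis by (simp add: bracket_def z)
  qed
qed

text \<open>As simplification rules these also rewrite unapplied sums of fields to lambda terms.\<close>

lemmas fun_simps = plus_fun_apply minus_apply uminus_apply scaleR_fun_apply fscale_apply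
declare fun_simps [simp del] zero_fun_apply [simp del]

subsection \<open>Orthonormal frames\<close>

text \<open>With the sums over the indices of \<open>E\<close> moved inside, they become an entry of
  a triple matrix product in \<open>trace_frame\<close>.\<close>

lemma sum4_reorder:
  "(\<Sum>i\<in>I. \<Sum>j\<in>J. \<Sum>k\<in>K. \<Sum>l\<in>L. f i j k l) = (\<Sum>k\<in>K. \<Sum>l\<in>L. \<Sum>j\<in>J. \<Sum>i\<in>I. f i j k l)"
proof -
  have "(\<Sum>i\<in>I. \<Sum>j\<in>J. \<Sum>k\<in>K. \<Sum>l\<in>L. f i j k l) = (\<Sum>j\<in>J. \<Sum>i\<in>I. \<Sum>k\<in>K. \<Sum>l\<in>L. f i j k l)"
    by (rule sum.swap)
  also have "\<dots> = (\<Sum>j\<in>J. \<Sum>k\<in>K. \<Sum>i\<in>I. \<Sum>l\<in>L. f i j k l)"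
    by (rule sum.cong[OF refl], rule sum.swap)
  also have "\<dots> = (\<Sum>k\<in>K. \<Sum>j\<in>J. \<Sum>i\<in>I. \<Sum>l\<in>L. f i j k l)"
    by (rule sum.swap)
  also have "\<dots> = (\<Sum>k\<in>K. \<Sum>j\<in>J. \<Sum>l\<in>L. \<Sum>i\<in>I. f i j k l)"
    by (rule sum.cong[OF refl], rule sum.cong[OF refl], rule sum.swap)
  also have "\<dots> = (\<Sum>k\<in>K. \<Sum>l\<in>L. \<Sum>j\<in>J. \<Sum>i\<in>I. f i j k l)"
    by (rule sum.cong[OF refl], rule sum.swap)
  finally show ?thesis .
qed

lemma sum_delta_mult:
  fixes f :: "'i::finite \<Rightarrow> real"
  shows "(\<Sum>k\<in>UNIV. (if i = k then a else 0) * f k) = a * f i"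
    and "(\<Sum>k\<in>UNIV. f k * (if k = i then c k else 0)) = f i * c i"
proof -
  have "(\<Sum>k\<in>UNIV. (if i = k then a else 0) * f k) = (\<Sum>k\<in>UNIV. if i = k then a * f k else 0)"
    by (rule sum.cong) auto
  then show "(\<Sum>k\<in>UNIV. (if i = k then a else 0) * f k) = a * f i" by simp
  have "(\<Sum>k\<in>UNIV. f k * (if k = i then c k else 0)) = (\<Sum>k\<in>UNIV. if k = i then f k * c k else 0)"
    by (rule sum.cong) auto
  then show "(\<Sum>k\<in>UNIV. f k * (if k = i then c k else 0)) = f i * c i" by simp
qed

lemma matrix_inv_unique:
  fixes M N :: "real ^ 'n ^ 'n"
  assumes "M ** N = mat 1" "N ** M = mat 1"
  shows "matrix_inv M = N"
proof -
  have "M ** matrix_inv M = mat 1 \<and> matrix_inv M ** M = mat 1"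
    unfolding matrix_inv_def by (rule someI[of _ N]) (use assms in simp)
  then show ?thesis
    using assms by (metis matrix_mul_assoc matrix_mul_lid matrix_mul_rid)
qed

text \<open>No group enters here. The signs are their own inverses, so \<open>eps i\<close> both
  raises and lowers an index.\<close>

locale orthonormal_frame =
  fixes A :: "('m::topological_space, 'e::euclidean_space) atlas"
    and g :: "'m metric_field" and D :: "'m connection"
    and X :: "'i::finite \<Rightarrow> 'm vfield" and eps :: "'i \<Rightarrow> real"
  assumes atlas: "smooth_atlas A"
    and metric: "pseudo_riemannian A g"
    and lc: "levi_civita A g D"
    and frame: "\<And>p. frame_at A X p"
    and orthonormal: "\<And>i j p. ip g (X i) (X j) p = (if i = j then eps i else 0)"
    and eps_square: "\<And>i. eps i * eps i = 1"
begin

lemma X_smooth: "smooth_vf A (X i)"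
  using frame by (auto simp: frame_at_def)

lemma vf_simps:
  "smooth_vf A Y \<Longrightarrow> smooth_vf A Z \<Longrightarrow> smooth_vf A (Y + Z)"
  "smooth_vf A Y \<Longrightarrow> smooth_vf A Z \<Longrightarrow> smooth_vf A (Y - Z)"
  "smooth_fun A f \<Longrightarrow> smooth_vf A Y \<Longrightarrow> smooth_vf A (fscale f Y)"
  "smooth_vf A Y \<Longrightarrow> smooth_vf A (c *\<^sub>R Y)"
  using smooth_vf_add smooth_vf_diff smooth_vf_fscale smooth_vf_scaleR atlas by auto

lemma smooth_vf_sum: "(\<And>i. i \<in> I \<Longrightarrow> smooth_vf A (Y i)) \<Longrightarrow> smooth_vf A (\<Sum>i\<in>I. Y i)"
  using subspace_sum[OF subspace_smooth_vf[OF atlas], of I Y] by auto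

lemma ip_smooth: "smooth_vf A Y \<Longrightarrow> smooth_vf A Z \<Longrightarrow> smooth_fun A (ip g Y Z)"
  using metric by (simp add: pseudo_riemannian_def)

lemma ip_sym:
  assumes "smooth_vf A Y" "smooth_vf A Z"
  shows "ip g Y Z p = ip g Z Y p"
  using metric smooth_vf_at[OF assms(1)] smooth_vf_at[OF assms(2)]
  by (simp add: pseudo_riemannian_def ip_def)

section \<open>Linearity of the metric and expansion in the frame\<close>

lemma g_lincomb:
  assumes "u \<in> tangent_space A p" "v \<in> tangent_space A p" "w \<in> tangent_space A p"
  shows "g p u (a *\<^sub>R v + b *\<^sub>R w) = a * g p u v + b * g p u w"
proof -
  have "linear_at A p (g p u)"
    using metric assms(1) unfolding pseudo_riemannian_def by blast
  then show ?thesis using assms(2,3) unfolding linear_at_def by simp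
qed

lemma ip_add_right:
  assumes "smooth_vf A Y" "smooth_vf A Z" "smooth_vf A W"
  shows "ip g Y (Z + W) p = ip g Y Z p + ip g Y W p"
  using g_lincomb[OF assms[THEN smooth_vf_at, of p], of 1 1]
  by (simp only: ip_def plus_fun_apply[of Z W] scaleR_one mult_1)

lemma ip_fscale_right:
  assumes "smooth_vf A Y" "smooth_vf A Z"
  shows "ip g Y (fscale f Z) p = f p * ip g Y Z p"
  using g_lincomb[OF assms(1,2,2)[THEN smooth_vf_at, of p], of "f p" 0]
  by (simp only: ip_def fscale_apply[of f Z] scaleR_zero_left mult_zero_left add_0_right)

lemma ip_add_left:
  assumes "smooth_vf A Y" "smooth_vf A Z" "smooth_vf A W"
  shows "ip g (Z + W) Y p = ip g Z Y p + ip g W Y p"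
  using ip_add_right[OF assms] assms by (simp add: ip_sym[of _ Y] vf_simps)

lemma ip_fscale_left:
  assumes "smooth_fun A f" "smooth_vf A Y" "smooth_vf A Z"
  shows "ip g (fscale f Z) Y p = f p * ip g Z Y p"
  using ip_fscale_right[OF assms(2,3)] assms by (simp add: ip_sym[of _ Y] vf_simps)

lemma ip_scaleR:
  assumes "smooth_vf A Y" "smooth_vf A Z"
  shows "ip g (c *\<^sub>R Z) Y p = c * ip g Z Y p" "ip g Y (c *\<^sub>R Z) p = c * ip g Y Z p"
  using ip_fscale_left[OF smooth_fun_const assms] ip_fscale_right[OF assms, of "\<lambda>_. c"]
  by (simp_all add: fscale_const)

lemma ip_minus_left: "smooth_vf A Y \<Longrightarrow> smooth_vf A Z \<Longrightarrow> ip g (- Z) Y p = - ip g Z Y p"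
  using ip_scaleR(1)[of Y Z "-1" p] by simp

lemma ip_diff_left:
  assumes "smooth_vf A Y" "smooth_vf A Z" "smooth_vf A W"
  shows "ip g (Z - W) Y p = ip g Z Y p - ip g W Y p"
  using ip_add_left[OF assms(1,2) vf_simps(4)[OF assms(3)], of "-1"]
    ip_scaleR(1)[OF assms(1,3), of "-1"]
  by simp

lemma ip_sum_left:
  assumes "smooth_vf A Y" "\<And>i. i \<in> I \<Longrightarrow> smooth_vf A (Z i)"
  shows "ip g (\<Sum>i\<in>I. c i *\<^sub>R Z i) Y p = (\<Sum>i\<in>I. c i * ip g (Z i) Y p)"
  using assms(2)
proof (induction I rule: infinite_finite_induct)
  case (insert i I)
  then show ?case
    using assms(1)
    by (simp add: ip_add_left ip_scaleR vf_simps smooth_vf_sum)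
qed (use ip_scaleR(1)[OF assms(1) smooth_vf_zero, of 0 p] in simp_all)

text \<open>The coefficients in the frame are smooth because they are values of the metric.\<close>

definition co :: "'m vfield \<Rightarrow> 'i \<Rightarrow> 'm \<Rightarrow> real"
  where "co Y i p = eps i * ip g Y (X i) p"

lemma co_smooth: "smooth_vf A Y \<Longrightarrow> smooth_fun A (co Y i)"
  using smooth_fun_cmult[OF atlas ip_smooth[OF _ X_smooth], of Y "eps i" i]
  by (simp add: co_def[abs_def])

lemma expansion_at:
  assumes "v \<in> tangent_space A p"
  shows "v = (\<Sum>i\<in>UNIV. (eps i * g p v (X i p)) *\<^sub>R X i p)"
proof -
  have inj: "inj (\<lambda>i. X i p)" and "span (range (\<lambda>i. X i p)) = tangent_space A p"
    using frame[of p] by (auto simp: frame_at_def)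
  with assms have "v \<in> range (\<lambda>u. \<Sum>w\<in>range (\<lambda>i. X i p). u w *\<^sub>R w)"
    by (simp only: span_finite[OF finite_imageI[OF finite]])
  then obtain u where "v = (\<Sum>w\<in>range (\<lambda>i. X i p). u w *\<^sub>R w)"
    by blast
  \<comment> \<open>The span is described by sums over the set of values; injectivity of the frame
    turns them into sums over indices. Pairing with \<open>X i\<close> then isolates one
    coefficient.\<close>
  then have v: "v = (\<Sum>j\<in>UNIV. u (X j p) *\<^sub>R X j p)"
    by (simp only: sum.reindex[OF inj] o_def)
  have "eps i * g p v (X i p) = u (X i p)" for i
  proof -
    have gl: "linear_at A p (g p (X i p))"
      using metric smooth_vf_at[OF X_smooth] unfolding pseudo_riemannian_def by blast
    have "g p v (X i p) = g p (X i p) v"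
      using metric smooth_vf_at[OF X_smooth] assms unfolding pseudo_riemannian_def by blast
    also have "\<dots> = (\<Sum>j\<in>UNIV. u (X j p) *\<^sub>R g p (X i p) (X j p))"
      unfolding v by (rule linear_at_sum[OF gl smooth_vf_at[OF X_smooth]])
    also have "\<dots> = u (X i p) * eps i"
      by (simp add: orthonormal[unfolded ip_def] if_distrib cong: if_cong)
    finally show ?thesis using eps_square[of i] by (simp add: algebra_simps)
  qed
  with v show ?thesis by simp
qed

lemma expansion:
  assumes "smooth_vf A Y"
  shows "Y = (\<Sum>i\<in>UNIV. fscale (co Y i) (X i))"
proof
  fix p
  have "(\<Sum>i\<in>UNIV. fscale (co Y i) (X i)) p = (\<Sum>i\<in>UNIV. co Y i p *\<^sub>R X i p)"
    by (simp only: sum_fun_apply[of "\<lambda>i. fscale (co Y i) (X i)"] fscale_apply[of "co Y i" "X i" for i])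
  then show "Y p = (\<Sum>i\<in>UNIV. fscale (co Y i) (X i)) p"
    using expansion_at[OF smooth_vf_at[OF assms]] by (simp only: co_def ip_def)
qed

text \<open>States directly that \<open>T\<close> sees only the coefficients at \<open>p\<close>, a
  form stable under sums and scaling. The general codomain admits tangent vectors as values, as
  required for the derivative of the curvature.\<close>

definition tensorial :: "'m \<Rightarrow> ('m vfield \<Rightarrow> 'b::real_vector) \<Rightarrow> bool"
  where "tensorial p T \<longleftrightarrow> (\<forall>Y. smooth_vf A Y \<longrightarrow> T Y = (\<Sum>i\<in>UNIV. co Y i p *\<^sub>R T (X i)))"

lemma tensorialD: "tensorial p T \<Longrightarrow> smooth_vf A Y \<Longrightarrow> T Y = (\<Sum>i\<in>UNIV. co Y i p *\<^sub>R T (X i))"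
  by (simp add: tensorial_def)

lemma tensorial_zero:
  "tensorial p T \<Longrightarrow> (\<And>i. T (X i) = 0) \<Longrightarrow> smooth_vf A Y \<Longrightarrow> T Y = 0"
  by (simp add: tensorial_def)

lemma tensorialI:
  assumes add: "\<And>Y Z. smooth_vf A Y \<Longrightarrow> smooth_vf A Z \<Longrightarrow> T (Y + Z) = T Y + T Z"
    and scale: "\<And>f Y. smooth_fun A f \<Longrightarrow> smooth_vf A Y \<Longrightarrow> T (fscale f Y) = f p *\<^sub>R T Y"
  shows "tensorial p T"
  unfolding tensorial_def
proof (intro allI impI)
  fix Y assume Y: "smooth_vf A Y"
  have T0: "T 0 = 0"
    using scale[OF smooth_fun_const smooth_vf_zero, of 0] by (simp add: fscale_const)
  have "T (\<Sum>i\<in>I. fscale (co Y i) (X i)) = (\<Sum>i\<in>I. co Y i p *\<^sub>R T (X i))" if "finite I" for I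
    using that
  proof induction
    case (insert i I)
    have "T (fscale (co Y i) (X i) + (\<Sum>i\<in>I. fscale (co Y i) (X i))) =
        co Y i p *\<^sub>R T (X i) + T (\<Sum>i\<in>I. fscale (co Y i) (X i))"
      by (subst add) (simp_all add: scale vf_simps co_smooth Y X_smooth smooth_vf_sum)
    with insert show ?case by (simp only: sum.insert[OF insert.hyps])
  qed (simp only: T0 sum.empty)
  from this[OF finite] show "T Y = (\<Sum>i\<in>UNIV. co Y i p *\<^sub>R T (X i))"
    using expansion[OF Y] by metis
qed

lemma tensorial_combine:
  "tensorial p T \<Longrightarrow> tensorial p S \<Longrightarrow> tensorial p (\<lambda>Y. T Y + S Y)"
  "tensorial p T \<Longrightarrow> tensorial p S \<Longrightarrow> tensorial p (\<lambda>Y. T Y - S Y)"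
  by (auto simp: tensorial_def scaleR_add_right sum.distrib scaleR_right_diff_distrib
      sum_subtractf scaleR_sum_right algebra_simps)

lemma tensorial_mult:
  fixes T :: "'m vfield \<Rightarrow> real"
  assumes "tensorial p T"
  shows "tensorial p (\<lambda>Y. c * T Y)" "tensorial p (\<lambda>Y. T Y * c)"
  using assms by (auto simp: tensorial_def sum_distrib_left sum_distrib_right algebra_simps)

lemma tensorial_sum:
  assumes "\<And>k. k \<in> K \<Longrightarrow> tensorial p (T k)"
  shows "tensorial p (\<lambda>Y. \<Sum>k\<in>K. T k Y)"
  unfolding tensorial_def
proof (intro allI impI)
  fix Y assume "smooth_vf A Y"
  then have "(\<Sum>k\<in>K. T k Y) = (\<Sum>k\<in>K. \<Sum>i\<in>UNIV. co Y i p *\<^sub>R T k (X i))"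
    using assms by (intro sum.cong refl tensorialD) auto
  also have "\<dots> = (\<Sum>i\<in>UNIV. co Y i p *\<^sub>R (\<Sum>k\<in>K. T k (X i)))"
    by (subst sum.swap) (simp add: scaleR_sum_right)
  finally show "(\<Sum>k\<in>K. T k Y) = (\<Sum>i\<in>UNIV. co Y i p *\<^sub>R (\<Sum>k\<in>K. T k (X i)))" .
qed

lemma tensorial_ip:
  assumes "smooth_vf A Z"
  shows "tensorial p (\<lambda>Y. ip g Y Z p)" "tensorial p (\<lambda>Y. ip g Z Y p)"
  using assms
  by (auto intro!: tensorialI simp: ip_add_left ip_fscale_left ip_add_right ip_fscale_right)

text \<open>With \<open>E i = (\<Sum>k. M i k *\<^sub>R X k)\<close> at \<open>p\<close>, the Gram matrix of \<open>E\<close> is \<open>M \<eta> M\<^sup>T\<close>, where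
  \<open>\<eta>\<close> is that of \<open>X\<close>; so conjugating its inverse by \<open>M\<close> gives \<open>\<eta>\<close> back.\<close>

lemma ginv_frame_change:
  fixes E :: "'i \<Rightarrow> 'm vfield"
  assumes E: "frame_at A E p"
  defines "M \<equiv> \<chi> i k. co (E i) k p"
  defines "\<eta> \<equiv> \<chi> i k. if i = k then eps i else 0"
  shows "transpose M ** ginv g E p ** M = \<eta>"
proof -
  have Es: "smooth_vf A (E i)" for i using E by (simp add: frame_at_def)
  have inj: "inj (\<lambda>i. E i p)" and ind: "independent (range (\<lambda>i. E i p))"
    using E by (auto simp: frame_at_def)
  have "\<eta> ** \<eta> = mat 1"
    by (simp add: \<eta>_def matrix_matrix_mult_def mat_def vec_eq_iff sum_delta_mult eps_square)
  have Ep: "E i p = (\<Sum>k\<in>UNIV. M $ i $ k *\<^sub>R X k p)" for i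
    using expansion_at[OF smooth_vf_at[OF Es], of i p] by (simp only: M_def co_def ip_def vec_lambda_beta)
  have "invertible (transpose M)"
    unfolding invertible_left_inverse matrix_left_invertible_ker
  proof (intro allI impI)
    fix v :: "real ^ 'i" assume v: "transpose M *v v = 0"
    have "(\<Sum>i\<in>UNIV. v $ i *\<^sub>R E i p) = (\<Sum>i\<in>UNIV. \<Sum>k\<in>UNIV. (v $ i * M $ i $ k) *\<^sub>R X k p)"
      by (simp only: Ep scaleR_sum_right scaleR_scaleR)
    also have "\<dots> = (\<Sum>k\<in>UNIV. (transpose M *v v) $ k *\<^sub>R X k p)"
      by (subst sum.swap)
        (simp only: matrix_vector_mult_def transpose_def vec_lambda_beta scaleR_sum_left mult.commute)
    also have "\<dots> = 0"
      by (simp only: v zero_index scaleR_zero_left sum.neutral_const)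
    finally have z: "(\<Sum>i\<in>UNIV. v $ i *\<^sub>R E i p) = 0" .
    have "(\<Sum>w\<in>range (\<lambda>i. E i p). v $ (inv (\<lambda>i. E i p) w) *\<^sub>R w) = 0"
      using z by (simp only: sum.reindex[OF inj] o_def inv_f_f[OF inj])
    then have "v $ (inv (\<lambda>i. E i p) (E i p)) = 0" for i
      using independentD[OF ind finite_imageI[OF finite] subset_refl,
          of "\<lambda>w. v $ (inv (\<lambda>i. E i p) w)" "E i p"] by blast
    then show "v = 0" by (simp add: inv_f_f[OF inj] vec_eq_iff)
  qed
  then obtain N where N: "N ** transpose M = mat 1" "transpose M ** N = mat 1"
    by (auto simp: invertible_def)
  have G: "(\<chi> i j. ip g (E i) (E j) p) = M ** \<eta> ** transpose M"
  proof -
    have "ip g (E i) (E j) p = (\<Sum>k\<in>UNIV. co (E i) k p * eps k * co (E j) k p)" for i j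
      using tensorialD[OF tensorial_ip(1)[OF Es[of j]] Es[of i], of p]
      by (simp add: co_def ip_sym[OF X_smooth Es] eps_square mult.assoc mult.left_commute[of "eps _"])
    then show ?thesis
      by (simp add: vec_eq_iff matrix_matrix_mult_def \<eta>_def M_def transpose_def sum_delta_mult)
  qed
  have M_N: "M ** transpose N = mat 1" "transpose N ** M = mat 1"
    using arg_cong[OF N(1), of transpose] arg_cong[OF N(2), of transpose]
    by (simp_all add: matrix_transpose_mul transpose_mat)
  have "ginv g E p = N ** \<eta> ** transpose N"
    unfolding ginv_def
  proof (rule matrix_inv_unique)
    have "M ** \<eta> ** transpose M ** (N ** \<eta> ** transpose N) = M ** (\<eta> ** (transpose M ** N) ** \<eta>) ** transpose N"
      by (simp add: matrix_mul_assoc)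
    then show "(\<chi> i j. ip g (E i) (E j) p) ** (N ** \<eta> ** transpose N) = mat 1"
      by (simp add: G N M_N \<open>\<eta> ** \<eta> = mat 1\<close>)
    have "N ** \<eta> ** transpose N ** (M ** \<eta> ** transpose M) = N ** (\<eta> ** (transpose N ** M) ** \<eta>) ** transpose M"
      by (simp add: matrix_mul_assoc)
    then show "(N ** \<eta> ** transpose N) ** (\<chi> i j. ip g (E i) (E j) p) = mat 1"
      by (simp add: G N M_N \<open>\<eta> ** \<eta> = mat 1\<close>)
  qed
  then have "transpose M ** ginv g E p ** M = (transpose M ** N) ** \<eta> ** (transpose N ** M)"
    by (simp add: matrix_mul_assoc)
  then show ?thesis by (simp add: N M_N)
qed

text \<open>Expanding both arguments of a bilinear form in \<open>X\<close> wraps the inverse Gram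
  matrix of \<open>E\<close> between the coefficient matrix and its transpose, which
  \<open>ginv_frame_change\<close> evaluates. This makes every trace independent of the basis chosen
  at \<open>p\<close>.\<close>

lemma trace_frame:
  fixes E :: "'i \<Rightarrow> 'm vfield" and T :: "'m vfield \<Rightarrow> 'm vfield \<Rightarrow> real"
  assumes E: "frame_at A E p"
    and T1: "\<And>Z. smooth_vf A Z \<Longrightarrow> tensorial p (\<lambda>Y. T Y Z)"
    and T2: "\<And>Y. smooth_vf A Y \<Longrightarrow> tensorial p (T Y)"
  shows "(\<Sum>i\<in>UNIV. \<Sum>j\<in>UNIV. ginv g E p $ i $ j * T (E i) (E j)) = (\<Sum>k\<in>UNIV. eps k * T (X k) (X k))"
proof -
  have Es: "smooth_vf A (E i)" for i using E by (simp add: frame_at_def)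
  have T: "T (E i) (E j) = (\<Sum>k\<in>UNIV. \<Sum>l\<in>UNIV. co (E i) k p * co (E j) l p * T (X k) (X l))" for i j
    using tensorialD[OF T1[OF Es[of j]] Es[of i]] tensorialD[OF T2[OF X_smooth] Es[of j]]
    by (simp add: sum_distrib_left mult.assoc)
  have "(\<Sum>i\<in>UNIV. \<Sum>j\<in>UNIV. ginv g E p $ i $ j * T (E i) (E j)) =
      (\<Sum>i\<in>UNIV. \<Sum>j\<in>UNIV. \<Sum>k\<in>UNIV. \<Sum>l\<in>UNIV.
        co (E i) k p * ginv g E p $ i $ j * co (E j) l p * T (X k) (X l))"
    by (simp add: T sum_distrib_left mult_ac)
  also have "\<dots> = (\<Sum>k\<in>UNIV. \<Sum>l\<in>UNIV. \<Sum>j\<in>UNIV. \<Sum>i\<in>UNIV.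
        co (E i) k p * ginv g E p $ i $ j * co (E j) l p * T (X k) (X l))"
    by (rule sum4_reorder)
  also have "\<dots> = (\<Sum>k\<in>UNIV. \<Sum>l\<in>UNIV.
        (transpose (\<chi> i k. co (E i) k p) ** ginv g E p ** (\<chi> i k. co (E i) k p)) $ k $ l * T (X k) (X l))"
    by (simp add: matrix_matrix_mult_def transpose_def sum_distrib_right)
  also have "\<dots> = (\<Sum>k\<in>UNIV. eps k * T (X k) (X k))"
    by (simp add: ginv_frame_change[OF E] sum_delta_mult)
  finally show ?thesis .
qed

lemma ginv_X: "ginv g X p $ i $ j = (if i = j then eps i else 0)"
proof -
  have "(\<chi> i k. co (X i) k p) = mat 1"
    by (auto simp: co_def orthonormal eps_square mat_def vec_eq_iff)
  then show ?thesis using ginv_frame_change[OF frame, of p] by (simp add: transpose_mat)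
qed

end

subsection \<open>Connection and curvature\<close>

context orthonormal_frame
begin

lemma affine: "affine_connection A D"
  using lc by (simp add: levi_civita_def)

lemma D_smooth: "smooth_vf A Y \<Longrightarrow> smooth_vf A Z \<Longrightarrow> smooth_vf A (D Y Z)"
  using affine by (simp add: affine_connection_def)

lemma D_add_left:
  "smooth_vf A Y \<Longrightarrow> smooth_vf A Z \<Longrightarrow> smooth_vf A W \<Longrightarrow> D (Y + Z) W = D Y W + D Z W"
  using affine unfolding affine_connection_def by blast

lemma D_add_right:
  "smooth_vf A Y \<Longrightarrow> smooth_vf A Z \<Longrightarrow> smooth_vf A W \<Longrightarrow> D W (Y + Z) = D W Y + D W Z"
  using affine unfolding affine_connection_def by blast

lemma D_fscale_left:
  "smooth_fun A f \<Longrightarrow> smooth_vf A Y \<Longrightarrow> smooth_vf A Z \<Longrightarrow> D (fscale f Y) Z = fscale f (D Y Z)"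
  using affine unfolding affine_connection_def by blast

lemma D_fscale_right:
  "smooth_fun A f \<Longrightarrow> smooth_vf A Y \<Longrightarrow> smooth_vf A Z \<Longrightarrow>
    D Y (fscale f Z) = fscale (\<lambda>p. Y p f) Z + fscale f (D Y Z)"
  using affine unfolding affine_connection_def by blast

lemma D_scaleR_left:
  "smooth_vf A Y \<Longrightarrow> smooth_vf A Z \<Longrightarrow> D (c *\<^sub>R Y) Z = c *\<^sub>R D Y Z"
  using D_fscale_left[OF smooth_fun_const, of Y Z c] by (simp add: fscale_const)

lemma D_scaleR_right:
  assumes "smooth_vf A Y" "smooth_vf A Z"
  shows "D Y (c *\<^sub>R Z) = c *\<^sub>R D Y Z"
proof -
  have "(\<lambda>p. Y p (\<lambda>q. c)) = (\<lambda>p. 0)"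
    using tangent_const[OF smooth_vf_at[OF assms(1)]] by blast
  then show ?thesis
    using D_fscale_right[OF smooth_fun_const assms, of c] by (simp add: fscale_const)
qed

lemma D_diff_left:
  assumes "smooth_vf A Y" "smooth_vf A Z" "smooth_vf A W"
  shows "D (Y - Z) W = D Y W - D Z W"
  using D_add_left[OF assms(1) vf_simps(4)[OF assms(2)] assms(3), of "-1"]
    D_scaleR_left[OF assms(2,3), of "-1"] by simp

lemma D_minus_right:
  "smooth_vf A Y \<Longrightarrow> smooth_vf A Z \<Longrightarrow> D Y (- Z) = - D Y Z"
  using D_scaleR_right[of Y Z "-1"] by simp

lemma torsion_free:
  "smooth_vf A Y \<Longrightarrow> smooth_vf A Z \<Longrightarrow> bracket Y Z = D Y Z - D Z Y"
  using lc by (simp add: levi_civita_def)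

lemma D_metric:
  "smooth_vf A Y \<Longrightarrow> smooth_vf A Z \<Longrightarrow> smooth_vf A W \<Longrightarrow>
    Y p (ip g Z W) = ip g (D Y Z) W p + ip g Z (D Y W) p"
  using lc unfolding levi_civita_def by blast

text \<open>Vanishing torsion expresses the bracket through \<open>D\<close>, so smoothness and,
  below, the Leibniz rule are inherited from the connection axioms.\<close>

lemma bracket_smooth: "smooth_vf A Y \<Longrightarrow> smooth_vf A Z \<Longrightarrow> smooth_vf A (bracket Y Z)"
  by (simp add: torsion_free D_smooth vf_simps)

lemma bracket_fscale_left:
  assumes "smooth_fun A f" "smooth_vf A Y" "smooth_vf A Z"
  shows "bracket (fscale f Y) Z = fscale f (bracket Y Z) - fscale (\<lambda>p. Z p f) Y"
  using assms
  by (simp add: torsion_free D_fscale_left D_fscale_right vf_simps)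
    (simp add: fun_eq_iff fun_simps algebra_simps)

section \<open>Tensoriality of the curvature and of its derivative\<close>

lemma curv_smooth:
  "smooth_vf A Y \<Longrightarrow> smooth_vf A Z \<Longrightarrow> smooth_vf A W \<Longrightarrow> smooth_vf A (curv D Y Z W)"
  by (simp add: curv_def D_smooth bracket_smooth vf_simps)

lemma curv_swap:
  assumes "smooth_vf A Y" "smooth_vf A Z" "smooth_vf A W"
  shows "curv D Y Z W = - curv D Z Y W"
  using D_scaleR_left[OF bracket_smooth[OF assms(1,2)] assms(3), of "-1"] bracket_swap[of Z Y]
  by (simp add: curv_def)

lemma curv_add_left:
  assumes "smooth_vf A Y" "smooth_vf A Y'" "smooth_vf A Z" "smooth_vf A W"
  shows "curv D (Y + Y') Z W = curv D Y Z W + curv D Y' Z W"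
  using assms
  by (simp add: curv_def D_add_left D_add_right bracket_add_left[OF atlas] D_smooth bracket_smooth vf_simps)

lemma curv_add_right:
  assumes "smooth_vf A W" "smooth_vf A W'" "smooth_vf A Y" "smooth_vf A Z"
  shows "curv D Y Z (W + W') = curv D Y Z W + curv D Y Z W'"
  using assms
  by (simp add: curv_def D_add_right D_smooth bracket_smooth vf_simps)

lemma curv_add_mid:
  assumes "smooth_vf A Z" "smooth_vf A Z'" "smooth_vf A Y" "smooth_vf A W"
  shows "curv D Y (Z + Z') W = curv D Y Z W + curv D Y Z' W"
  using curv_add_left[OF assms] assms by (simp add: curv_swap[of Y] vf_simps)

text \<open>Differentiating \<open>fscale f (D Y W)\<close> along \<open>Z\<close> leaves a term
  with the derivative of \<open>f\<close>; the Leibniz rule of the bracket produces the same term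
  with the opposite sign.\<close>

lemma curv_fscale_left:
  assumes "smooth_fun A f" "smooth_vf A Y" "smooth_vf A Z" "smooth_vf A W"
  shows "curv D (fscale f Y) Z W = fscale f (curv D Y Z W)"
proof -
  have "smooth_fun A (\<lambda>p. Z p f)" by (rule smooth_vf_deriv[OF assms(3,1)])
  with assms show ?thesis
    by (simp add: curv_def D_fscale_left D_fscale_right bracket_fscale_left D_diff_left
        D_smooth bracket_smooth vf_simps)
      (simp add: fun_eq_iff fun_simps algebra_simps)
qed

lemma curv_fscale_mid:
  assumes "smooth_fun A f" "smooth_vf A Y" "smooth_vf A Z" "smooth_vf A W"
  shows "curv D Y (fscale f Z) W = fscale f (curv D Y Z W)"
  using curv_fscale_left[OF assms(1,3,2,4)] assms
  by (simp add: curv_swap[of Y] vf_simps) (simp add: fun_eq_iff fun_simps)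

text \<open>The mixed first-order terms cancel in pairs, and the two second derivatives of
  \<open>f\<close> are cancelled by its derivative along \<open>bracket Y Z\<close>.\<close>

lemma curv_fscale_right:
  assumes "smooth_fun A f" "smooth_vf A Y" "smooth_vf A Z" "smooth_vf A W"
  shows "curv D Y Z (fscale f W) = fscale f (curv D Y Z W)"
proof -
  have "smooth_fun A (\<lambda>p. Y p f)" "smooth_fun A (\<lambda>p. Z p f)"
    using smooth_vf_deriv assms by blast+
  with assms show ?thesis
    by (simp add: curv_def D_fscale_right D_add_right D_smooth bracket_smooth vf_simps)
      (simp add: fun_eq_iff fun_simps bracket_def algebra_simps)
qed

lemma tensorial_Rm:
  assumes "smooth_vf A Y" "smooth_vf A Z" "smooth_vf A W"
  shows "tensorial p (\<lambda>V. Rm g D V Y Z W p)" "tensorial p (\<lambda>V. Rm g D Y V Z W p)"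
    "tensorial p (\<lambda>V. Rm g D Y Z V W p)" "tensorial p (\<lambda>V. Rm g D Y Z W V p)"
  using assms
  by (auto intro!: tensorialI simp: Rm_def curv_add_left curv_add_mid curv_add_right
      curv_fscale_left curv_fscale_mid curv_fscale_right ip_add_left ip_add_right
      ip_fscale_left ip_fscale_right curv_smooth)

lemma ricci_trace:
  assumes "frame_at A (E :: 'i \<Rightarrow> 'm vfield) p" "smooth_vf A Y" "smooth_vf A Z"
  shows "ricci g D E Y Z p = (\<Sum>i\<in>UNIV. eps i * Rm g D (X i) Y Z (X i) p)"
  unfolding ricci_def
  by (rule trace_frame[OF assms(1)]) (use assms(2,3) in \<open>auto intro: tensorial_Rm\<close>)

text \<open>\<open>ricci_trace\<close> speaks of smooth fields only; agreement there suffices, since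
  \<open>tensorial\<close> tests nothing else.\<close>

lemma tensorial_cong:
  assumes "\<And>Y. smooth_vf A Y \<Longrightarrow> T Y = S Y" "tensorial p S"
  shows "tensorial p T"
  using tensorialD[OF assms(2)] by (simp add: tensorial_def assms(1) X_smooth)

lemma tensorial_ricci:
  assumes "frame_at A (E :: 'i \<Rightarrow> 'm vfield) p" "smooth_vf A Z"
  shows "tensorial p (\<lambda>Y. ricci g D E Y Z p)" "tensorial p (\<lambda>Y. ricci g D E Z Y p)"
  by (rule tensorial_cong[OF ricci_trace[OF assms(1)]];
      use assms(2) in \<open>auto intro!: tensorial_sum tensorial_mult tensorial_Rm X_smooth\<close>)+

lemma scalar_trace:
  assumes "frame_at A (E :: 'i \<Rightarrow> 'm vfield) p"
  shows "scalar_curv g D E p = (\<Sum>k\<in>UNIV. eps k * ricci g D E (X k) (X k) p)"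
  unfolding scalar_curv_def
  by (rule trace_frame[OF assms]) (auto intro: tensorial_ricci assms)

text \<open>In the slots of the curvature, the derivative of \<open>f\<close> produced by the outer
  \<open>D U\<close> is cancelled by the one from \<open>D U\<close> applied inside that
  slot.\<close>

lemma tensorial_nabla_curv:
  assumes "smooth_vf A U" "smooth_vf A Y" "smooth_vf A Z"
  shows "tensorial p (\<lambda>V. nabla_curv D V U Y Z p)" "tensorial p (\<lambda>V. nabla_curv D U V Y Z p)"
    "tensorial p (\<lambda>V. nabla_curv D U Y V Z p)" "tensorial p (\<lambda>V. nabla_curv D U Y Z V p)"
proof -
  note s = nabla_curv_def D_add_left D_add_right D_fscale_left D_fscale_right
    curv_add_left curv_add_mid curv_add_right
    curv_fscale_left curv_fscale_mid curv_fscale_right curv_smooth D_smooth vf_simps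
    smooth_vf_deriv
  show "tensorial p (\<lambda>V. nabla_curv D V U Y Z p)"
    by (rule tensorialI; use assms in \<open>simp add: s\<close>;
        simp add: fun_simps scaleR_diff_right)
  show "tensorial p (\<lambda>V. nabla_curv D U V Y Z p)" "tensorial p (\<lambda>V. nabla_curv D U Y V Z p)"
    "tensorial p (\<lambda>V. nabla_curv D U Y Z V p)"
    by (rule tensorialI; use assms in \<open>simp add: s\<close>;
        simp add: fun_simps scaleR_diff_right)+
qed

text \<open>Frame fields are replaced by arbitrary ones one slot at a time, each step using the
  vanishing obtained in the previous one.\<close>

lemma nabla_curv_zeroI:
  assumes "\<And>i j k l. nabla_curv D (X i) (X j) (X k) (X l) = 0"
    and "smooth_vf A U" "smooth_vf A V" "smooth_vf A Y" "smooth_vf A Z"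
  shows "nabla_curv D U V Y Z = 0"
proof
  fix p
  have 1: "nabla_curv D U (X j) (X k) (X l) p = 0" for j k l
    using tensorial_zero[OF tensorial_nabla_curv(1)[OF X_smooth X_smooth X_smooth] _ assms(2), of _ _ _ p]
    by (simp add: assms(1) zero_fun_def)
  have 2: "nabla_curv D U V (X k) (X l) p = 0" for k l
    by (rule tensorial_zero[OF tensorial_nabla_curv(2)[OF assms(2) X_smooth X_smooth] 1 assms(3)])
  have 3: "nabla_curv D U V Y (X l) p = 0" for l
    by (rule tensorial_zero[OF tensorial_nabla_curv(3)[OF assms(2,3) X_smooth] 2 assms(4)])
  have "nabla_curv D U V Y Z p = 0"
    by (rule tensorial_zero[OF tensorial_nabla_curv(4)[OF assms(2,3,4)] 3 assms(5)])
  then show "nabla_curv D U V Y Z p = 0 p" by (simp only: zero_fun_apply)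
qed

subsection \<open>Almost product structures\<close>

lemma endo_smooth: "almost_product A P \<Longrightarrow> smooth_vf A Y \<Longrightarrow> smooth_vf A (endo P Y)"
  by (simp add: almost_product_def)

lemma endo_lincomb_at:
  assumes "almost_product A P" "smooth_vf A Y" "smooth_vf A Z"
  shows "P p (a *\<^sub>R Y p + b *\<^sub>R Z p) = a *\<^sub>R P p (Y p) + b *\<^sub>R P p (Z p)"
proof -
  have "linear_at A p (P p)" using assms(1) by (simp add: almost_product_def)
  then show ?thesis
    using smooth_vf_at[OF assms(2)] smooth_vf_at[OF assms(3)] unfolding linear_at_def by blast
qed

lemma endo_add:
  assumes "almost_product A P" "smooth_vf A Y" "smooth_vf A Z"
  shows "endo P (Y + Z) = endo P Y + endo P Z"
proof
  show "endo P (Y + Z) p = (endo P Y + endo P Z) p" for p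
    using endo_lincomb_at[OF assms, of p 1 1]
    by (simp only: endo_def plus_fun_apply[of Y] plus_fun_apply[of "\<lambda>p. P p (Y p)"] scaleR_one)
qed

lemma endo_fscale:
  assumes "almost_product A P" "smooth_vf A Y"
  shows "endo P (fscale f Y) = fscale f (endo P Y)"
proof
  show "endo P (fscale f Y) p = fscale f (endo P Y) p" for p
    using endo_lincomb_at[OF assms assms(2), of p "f p" 0]
    by (simp only: endo_def fscale_apply[of f Y] fscale_apply[of f "\<lambda>p. P p (Y p)"]
        scaleR_zero_left add_0_right)
qed

lemma endo_scaleR:
  "almost_product A P \<Longrightarrow> smooth_vf A Y \<Longrightarrow> endo P (c *\<^sub>R Y) = c *\<^sub>R endo P Y"
  using endo_fscale[of P Y "\<lambda>_. c"] by (simp add: fscale_const)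

lemma nabla_endo_smooth:
  "almost_product A P \<Longrightarrow> smooth_vf A Y \<Longrightarrow> smooth_vf A Z \<Longrightarrow> smooth_vf A (nabla_endo D P Y Z)"
  by (simp add: nabla_endo_def D_smooth endo_smooth vf_simps)

lemma nabla_endo_add:
  assumes "almost_product A P" "smooth_vf A Y" "smooth_vf A Z" "smooth_vf A W"
  shows "nabla_endo D P (Y + Z) W = nabla_endo D P Y W + nabla_endo D P Z W"
    "nabla_endo D P W (Y + Z) = nabla_endo D P W Y + nabla_endo D P W Z"
  using assms by (simp_all add: nabla_endo_def endo_add D_add_left D_add_right D_smooth endo_smooth)

lemma nabla_endo_fscale:
  assumes "almost_product A P" "smooth_fun A f" "smooth_vf A Y" "smooth_vf A W"
  shows "nabla_endo D P (fscale f Y) W = fscale f (nabla_endo D P Y W)"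
    "nabla_endo D P W (fscale f Y) = fscale f (nabla_endo D P W Y)"
proof -
  show "nabla_endo D P (fscale f Y) W = fscale f (nabla_endo D P Y W)"
    using assms
    by (simp add: nabla_endo_def endo_fscale D_fscale_left D_smooth endo_smooth)
      (simp add: fun_eq_iff fun_simps algebra_simps)
  have "smooth_fun A (\<lambda>p. W p f)" by (rule smooth_vf_deriv[OF assms(4,2)])
  with assms show "nabla_endo D P W (fscale f Y) = fscale f (nabla_endo D P W Y)"
    by (simp add: nabla_endo_def endo_add endo_fscale D_fscale_right D_smooth endo_smooth vf_simps)
      (simp add: fun_eq_iff fun_simps algebra_simps)
qed

lemma tensorial_nabla_endo_ip:
  assumes "almost_product A P" "smooth_vf A Y" "smooth_vf A Z"
  shows "tensorial p (\<lambda>V. ip g (nabla_endo D P V Y) Z p)"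
    "tensorial p (\<lambda>V. ip g (nabla_endo D P Y V) Z p)"
    "tensorial p (\<lambda>V. ip g Z (nabla_endo D P V Y) p)"
    "tensorial p (\<lambda>V. ip g Z (nabla_endo D P Y V) p)"
  using assms
  by (auto intro!: tensorialI simp: nabla_endo_add nabla_endo_fscale nabla_endo_smooth
      ip_add_left ip_add_right ip_fscale_left ip_fscale_right)

lemma tensorial_F:
  assumes "almost_product A P" "smooth_vf A Y" "smooth_vf A Z"
  shows "tensorial p (\<lambda>V. F_tensor g D P V Y Z p)" "tensorial p (\<lambda>V. F_tensor g D P Y V Z p)"
    "tensorial p (\<lambda>V. F_tensor g D P Y Z V p)"
  using assms
  by (auto simp: F_tensor_def intro: tensorial_nabla_endo_ip tensorial_ip nabla_endo_smooth)

lemma W3I: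
  assumes P: "almost_product A P"
    and cyc: "\<And>i j k p. F_tensor g D P (X i) (X j) (X k) p + F_tensor g D P (X j) (X k) (X i) p +
      F_tensor g D P (X k) (X i) (X j) p = 0"
  shows "W3_manifold A g D P"
  unfolding W3_manifold_def
proof (intro allI impI)
  fix U V W p assume s: "smooth_vf A U" "smooth_vf A V" "smooth_vf A W"
  \<comment> \<open>The single values of \<open>F_tensor\<close> do not vanish on the frame, so the
    whole cyclic sum must be treated as one tensor.\<close>
  let ?T = "\<lambda>U V W. F_tensor g D P U V W p + F_tensor g D P V W U p + F_tensor g D P W U V p"
  have 1: "?T U (X j) (X k) = 0" for j k
    by (rule tensorial_zero[where p = p and T = "\<lambda>U. ?T U (X j) (X k)", OF _ cyc s(1)])
      (intro tensorial_combine tensorial_F P X_smooth)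
  have 2: "?T U V (X k) = 0" for k
    by (rule tensorial_zero[where p = p and T = "\<lambda>V. ?T U V (X k)", OF _ 1 s(2)])
      (intro tensorial_combine tensorial_F P X_smooth s)
  show "?T U V W = 0"
    by (rule tensorial_zero[where p = p and T = "?T U V", OF _ 2 s(3)])
      (intro tensorial_combine tensorial_F P X_smooth s)
qed

lemma nablaP_trace:
  assumes P: "almost_product A P" and E: "frame_at A (E :: 'i \<Rightarrow> 'm vfield) p"
  shows "nablaP_sqnorm g D P E p = (\<Sum>i\<in>UNIV. \<Sum>k\<in>UNIV. eps i * eps k *
    ip g (nabla_endo D P (X i) (X k)) (nabla_endo D P (X i) (X k)) p)"
proof -
  have Es: "smooth_vf A (E i)" for i using E by (simp add: frame_at_def)
  let ?N = "nabla_endo D P"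
  let ?T = "\<lambda>Y Z. \<Sum>k\<in>UNIV. eps k * ip g (?N Y (X k)) (?N Z (X k)) p"
  \<comment> \<open>The fourfold sum is a trace of traces. This is the inner one, over the second
    slots; its value is again bilinear in \<open>Y\<close> and \<open>Z\<close>, so that the outer
    trace can be taken.\<close>
  have T: "(\<Sum>k\<in>UNIV. \<Sum>s\<in>UNIV. ginv g E p $ k $ s * ip g (?N Y (E k)) (?N Z (E s)) p) = ?T Y Z"
    if "smooth_vf A Y" "smooth_vf A Z" for Y Z
    by (rule trace_frame[OF E]) (intro tensorial_nabla_endo_ip nabla_endo_smooth P that, assumption)+
  have "nablaP_sqnorm g D P E p =
      (\<Sum>i\<in>UNIV. \<Sum>j\<in>UNIV. ginv g E p $ i $ j * ?T (E i) (E j))"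
    by (simp add: nablaP_sqnorm_def T[OF Es Es, symmetric] sum_distrib_left mult.assoc)
  also have "\<dots> = (\<Sum>i\<in>UNIV. eps i * ?T (X i) (X i))"
    by (rule trace_frame[OF E])
      (intro tensorial_sum tensorial_mult tensorial_nabla_endo_ip nabla_endo_smooth P X_smooth, assumption)+
  finally show ?thesis by (simp add: sum_distrib_left mult.assoc)
qed

end

subsection \<open>Bi-invariant metrics\<close>

text \<open>\<open>C_skew\<close> is the skewness of \<open>ad\<close>. Together with that of the
  bracket it makes the lowered constants totally skew, that is, a 3-form.\<close>

locale biinvariant_frame = orthonormal_frame A g D X eps
  for A :: "('m::topological_space, 'e::euclidean_space) atlas"
    and g D and X :: "'i::finite \<Rightarrow> 'm vfield" and eps +
  fixes C :: "'i \<Rightarrow> 'i \<Rightarrow> 'i \<Rightarrow> real"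
  assumes bracket_X: "\<And>i j. bracket (X i) (X j) = (\<Sum>k\<in>UNIV. C i j k *\<^sub>R X k)"
    and C_skew: "\<And>i j k. C i j k * eps k = - (C i k j * eps j)"
begin

lemma ip_sum_X: "ip g (\<Sum>k\<in>UNIV. c k *\<^sub>R X k) (X j) p = c j * eps j"
  by (simp add: ip_sum_left X_smooth orthonormal if_distrib cong: if_cong)

lemma ip_bracket_X: "ip g (bracket (X i) (X j)) (X k) p = C i j k * eps k"
  by (simp add: bracket_X ip_sum_X)

lemma vf_eqI:
  assumes "smooth_vf A Y" "smooth_vf A Z" "\<And>i p. ip g Y (X i) p = ip g Z (X i) p"
  shows "Y = Z"
proof -
  have "co Y = co Z" using assms(3) by (simp add: co_def fun_eq_iff)
  then show ?thesis using expansion[OF assms(1)] expansion[OF assms(2)] by simp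
qed

text \<open>The difference of the two sides of the claim is symmetric in its first two and
  skew in its last two indices.\<close>

lemma D_X: "D (X i) (X j) = (1/2) *\<^sub>R bracket (X i) (X j)"
proof (rule vf_eqI)
  fix k p
  define S where "S = (\<lambda>i j k. ip g (D (X i) (X j)) (X k) p - C i j k * eps k / 2)"
  have sym: "S i j k = S j i k" for i j k
  proof -
    have "C i j k * eps k = ip g (D (X i) (X j)) (X k) p - ip g (D (X j) (X i)) (X k) p" for i j
      using ip_bracket_X[of i j k p] by (simp add: torsion_free ip_diff_left X_smooth D_smooth)
    from this[of i j] this[of j i] show ?thesis by (simp add: S_def field_simps)
  qed
  have skew: "S i j k = - S i k j" for i j k
  proof -
    have "ip g (X j) (X k) = (\<lambda>p. if j = k then eps j else 0)"
      using orthonormal by blast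
    then have "X i p (ip g (X j) (X k)) = 0"
      using tangent_const[OF smooth_vf_at[OF X_smooth]] by simp
    then have "ip g (D (X i) (X j)) (X k) p + ip g (D (X i) (X k)) (X j) p = 0"
      using D_metric[OF X_smooth X_smooth X_smooth, of i p j k]
      by (simp add: ip_sym[of "X j"] X_smooth D_smooth)
    then show ?thesis using C_skew[of i j k] by (simp add: S_def field_simps)
  qed
  have "S i j k = 0"
    using skew[of i j k] sym[of i k j] skew[of k i j] sym[of k j i] skew[of j k i] sym[of j i k]
    by simp
  then show "ip g (D (X i) (X j)) (X k) p = ip g ((1/2) *\<^sub>R bracket (X i) (X j)) (X k) p"
    by (simp add: ip_scaleR X_smooth bracket_smooth ip_bracket_X S_def)
qed (simp_all add: D_smooth bracket_smooth X_smooth vf_simps)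

text \<open>The fields with constant coefficients. They form a Lie algebra closed under
  \<open>D\<close>, so iterated covariant derivatives remain iterated brackets.\<close>

definition invariants :: "'m vfield set" where "invariants = span (range X)"

lemma invariants_closed:
  "X i \<in> invariants" "Y \<in> invariants \<Longrightarrow> c *\<^sub>R Y \<in> invariants"
  "Y \<in> invariants \<Longrightarrow> Z \<in> invariants \<Longrightarrow> Y + Z \<in> invariants"
  "(\<And>i. i \<in> I \<Longrightarrow> F i \<in> invariants) \<Longrightarrow> (\<Sum>i\<in>I. F i) \<in> invariants"
  by (auto simp: invariants_def span_base span_scale span_add span_sum)

lemma invariants_smooth:
  assumes "Y \<in> invariants"
  shows "smooth_vf A Y"
  using assms unfolding invariants_def
  by (induction rule: span_induct_alt) (auto simp: smooth_vf_zero X_smooth vf_simps)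

text \<open>Scaling and addition are separate steps here, to match the bilinearity rules of
  \<open>bracket\<close> and \<open>D\<close>.\<close>

lemma invariants_induct [consumes 1, case_names X scale add]:
  assumes "Y \<in> invariants" "\<And>i. P (X i)"
    and scale: "\<And>c Z. Z \<in> invariants \<Longrightarrow> P Z \<Longrightarrow> P (c *\<^sub>R Z)"
    and add: "\<And>Z W. Z \<in> invariants \<Longrightarrow> W \<in> invariants \<Longrightarrow> P Z \<Longrightarrow> P W \<Longrightarrow> P (Z + W)"
  shows "P Y"
proof -
  have P0: "P 0" using scale[OF invariants_closed(1) assms(2), of 0] by simp
  have "Y \<in> invariants \<and> P Y"
    using assms(1) unfolding invariants_def
  proof (induction rule: span_induct_alt)
    case base
    then show ?case using P0 by (simp add: span_zero)
  next
    case (step c Z W)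
    then show ?case
      unfolding invariants_def[symmetric] by (auto intro!: invariants_closed scale add assms(2))
  qed
  then show ?thesis ..
qed

lemmas bilinear_bracket =
  bracket_add_left[OF atlas] bracket_add_right[OF atlas]
  bracket_scaleR_left[OF atlas] bracket_scaleR_right[OF atlas]

lemma bracket_invariants:
  assumes "Y \<in> invariants" "Z \<in> invariants"
  shows "bracket Y Z \<in> invariants"
  using assms(1)
proof (induction rule: invariants_induct)
  case (X i)
  show ?case using assms(2)
    by (induction rule: invariants_induct)
      (auto simp: bracket_X bilinear_bracket X_smooth invariants_smooth intro!: invariants_closed)
qed (use assms(2) in \<open>simp_all add: bilinear_bracket invariants_smooth invariants_closed\<close>)

lemma D_invariants:
  assumes "Y \<in> invariants" "Z \<in> invariants"
  shows "D Y Z = (1/2) *\<^sub>R bracket Y Z"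
  using assms(1)
proof (induction rule: invariants_induct)
  case (X i)
  show ?case using assms(2)
    by (induction rule: invariants_induct)
      (auto simp: D_X D_add_right D_scaleR_right bilinear_bracket X_smooth
        invariants_smooth scaleR_add_right)
qed (use assms(2) in \<open>simp_all add: D_add_left D_scaleR_left bilinear_bracket invariants_smooth
    scaleR_add_right\<close>)

lemma ip_bracket_invariants:
  assumes "Y \<in> invariants" "Z \<in> invariants" "W \<in> invariants"
  shows "ip g (bracket Y Z) W p + ip g (bracket Y W) Z p = 0"
  using assms(1)
proof (induction rule: invariants_induct)
  case (X i)
  show ?case using assms(2)
  proof (induction rule: invariants_induct)
    case (X j)
    show ?case using assms(3)
    proof (induction rule: invariants_induct)
      case (X k)
      show ?case using C_skew[of i j k] by (simp add: ip_bracket_X)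
    qed (auto simp: ip_add_left ip_add_right ip_scaleR bilinear_bracket
          X_smooth invariants_smooth bracket_smooth algebra_simps simp flip: distrib_left)
  qed (use assms(3) in \<open>auto simp: ip_add_left ip_add_right ip_scaleR bilinear_bracket
          X_smooth invariants_smooth bracket_smooth algebra_simps simp flip: distrib_left\<close>)
qed (use assms(2,3) in \<open>auto simp: ip_add_left ip_add_right ip_scaleR bilinear_bracket
          X_smooth invariants_smooth bracket_smooth algebra_simps simp flip: distrib_left\<close>)

lemma jacobi_invariants:
  assumes "Y \<in> invariants" "Z \<in> invariants" "W \<in> invariants"
  shows "bracket Y (bracket Z W) = bracket (bracket Y Z) W + bracket Z (bracket Y W)"
  using bracket_jacobi[OF atlas] assms[THEN invariants_smooth] by blast

text \<open>The two second derivatives give \<open>1/4\<close> of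
  \<open>bracket (bracket Y Z) W\<close> by Jacobi; the term with \<open>D (bracket Y Z)\<close>
  takes away \<open>1/2\<close>.\<close>

lemma curv_invariants:
  assumes "Y \<in> invariants" "Z \<in> invariants" "W \<in> invariants"
  shows "curv D Y Z W = (-1/4) *\<^sub>R bracket (bracket Y Z) W"
  using assms
  by (simp add: curv_def D_invariants bracket_invariants invariants_closed bilinear_bracket
      invariants_smooth bracket_smooth jacobi_invariants[OF assms] scaleR_add_right
      flip: scaleR_left_diff_distrib)

lemma nabla_curv_invariants:
  assumes "U \<in> invariants" "Y \<in> invariants" "Z \<in> invariants" "W \<in> invariants"
  shows "nabla_curv D U Y Z W = 0"
proof -
  \<comment> \<open>Two uses of Jacobi let \<open>U\<close> act on each factor of the double
    bracket; up to the common factor \<open>-1/8\<close> this is the vanishing of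
    \<open>nabla_curv\<close>.\<close>
  have "bracket U (bracket (bracket Y Z) W) =
      bracket (bracket (bracket U Y) Z) W + bracket (bracket Y (bracket U Z)) W +
      bracket (bracket Y Z) (bracket U W)"
    using assms jacobi_invariants[of U "bracket Y Z" W] jacobi_invariants[of U Y Z]
    by (simp add: bracket_invariants bilinear_bracket invariants_smooth)
  with assms show ?thesis
    by (simp add: nabla_curv_def D_invariants curv_invariants bracket_invariants invariants_closed
        bilinear_bracket invariants_smooth bracket_smooth vf_simps scaleR_add_right D_minus_right
        D_scaleR_right)
qed

lemma locally_symmetric: "locally_symmetric A D"
  unfolding locally_symmetric_def
  using nabla_curv_zeroI nabla_curv_invariants invariants_closed(1) by blast

text \<open>Skewness of \<open>ad\<close> moves the outer bracket across the metric: the curvature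
  is \<open>-1/4\<close> of the product of \<open>bracket (X i) (X j)\<close> and
  \<open>bracket (X k) (X s)\<close>, so its pair symmetry becomes visible.\<close>

lemma Rm_X: "Rm g D (X i) (X j) (X k) (X s) p = -1/4 * (\<Sum>m\<in>UNIV. C i j m * C k s m * eps m)"
proof -
  have b: "bracket (X i) (X j) \<in> invariants" for i j
    by (intro bracket_invariants invariants_closed)
  have "ip g (bracket (bracket (X i) (X j)) (X k)) (X s) p =
      - ip g (bracket (X k) (bracket (X i) (X j))) (X s) p"
    using ip_scaleR(1)[of "X s" "bracket (X k) (bracket (X i) (X j))" "-1" p]
      bracket_swap[of "bracket (X i) (X j)" "X k"]
    by (simp add: X_smooth bracket_smooth)
  also have "\<dots> = ip g (bracket (X k) (X s)) (bracket (X i) (X j)) p"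
    using ip_bracket_invariants[OF invariants_closed(1) b invariants_closed(1), of k i j s p] by simp
  also have "\<dots> = (\<Sum>m\<in>UNIV. C k s m * ip g (X m) (bracket (X i) (X j)) p)"
    by (subst (1) bracket_X[of k s]) (simp add: ip_sum_left X_smooth bracket_smooth)
  also have "\<dots> = (\<Sum>m\<in>UNIV. C i j m * C k s m * eps m)"
    by (simp add: ip_sym[of "X _" "bracket _ _"] X_smooth bracket_smooth ip_bracket_X mult_ac)
  finally show ?thesis
    by (simp add: Rm_def curv_invariants invariants_closed ip_scaleR ip_minus_left
        X_smooth bracket_smooth vf_simps)
qed

text \<open>A left invariant field has constant coefficients because the group acts transitively.\<close>

lemma left_invariant_imp_invariants:
  assumes G: "group mul e iv" and inv: "left_invariant_metric A mul g"
    and X: "\<And>i. left_invariant_vf A mul (X i)" and Y: "left_invariant_vf A mul Y"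
  shows "Y \<in> invariants"
proof -
  have Ys: "smooth_vf A Y" using Y by (simp add: left_invariant_vf_def)
  have "co Y i p = co Y i e" for i p
  proof -
    interpret gr: group mul e iv by (rule G)
    have "mul p e = p" by (rule gr.right_neutral)
    then have "ip g Y (X i) p = g (mul p e) (Y (mul p e)) (X i (mul p e))"
      by (simp add: ip_def)
    also have "\<dots> = g (mul p e) (differential A (mul p) (Y e)) (differential A (mul p) (X i e))"
      using X[of i] Y unfolding left_invariant_vf_def by metis
    also have "\<dots> = g e (Y e) (X i e)"
      using inv smooth_vf_at[OF Ys] smooth_vf_at[OF X_smooth] unfolding left_invariant_metric_def
      by blast
    finally show ?thesis by (simp add: co_def ip_def)
  qed
  then obtain a where "\<And>i p. co Y i p = a i"
    using that[of "\<lambda>i. co Y i e"] by blast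
  then have "co Y i = (\<lambda>p. a i)" for i by blast
  then have "Y = (\<Sum>i\<in>UNIV. a i *\<^sub>R X i)"
    using expansion[OF Ys] by (simp only: fscale_const)
  moreover have "(\<Sum>i\<in>UNIV. a i *\<^sub>R X i) \<in> invariants"
    by (intro invariants_closed)
  ultimately show ?thesis by simp
qed

lemma killing:
  assumes "group mul e iv" "left_invariant_metric A mul g" "\<And>i. left_invariant_vf A mul (X i)"
  shows "killing_metric A mul g"
  unfolding killing_metric_def
  using ip_bracket_invariants left_invariant_imp_invariants[OF assms] by blast

section \<open>Derivatives of \<open>P\<close> and the tensor \<open>nijenhuis\<close> on
  eigenvectors of \<open>P\<close>\<close>

lemma endo_bracket_X:
  assumes P: "almost_product A P" and PX: "\<And>i. endo P (X i) = sg i *\<^sub>R X i"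
  shows "endo P (bracket (X i) (X j)) = (\<Sum>k\<in>UNIV. (C i j k * sg k) *\<^sub>R X k)"
proof -
  have "endo P (\<Sum>k\<in>K. c k *\<^sub>R X k) = (\<Sum>k\<in>K. (c k * sg k) *\<^sub>R X k)" if "finite K" for K c
    using that
  proof induction
    case empty
    show ?case using endo_scaleR[OF P smooth_vf_zero, of 0] by simp
  qed (simp add: endo_add[OF P] endo_scaleR[OF P] PX X_smooth vf_simps smooth_vf_sum)
  then show ?thesis by (simp add: bracket_X)
qed

lemma nabla_endo_X:
  assumes P: "almost_product A P" and PX: "\<And>i. endo P (X i) = sg i *\<^sub>R X i"
  shows "nabla_endo D P (X i) (X j) = (\<Sum>k\<in>UNIV. (C i j k * (sg j - sg k) / 2) *\<^sub>R X k)"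
proof -
  have "nabla_endo D P (X i) (X j) = (sg j / 2) *\<^sub>R bracket (X i) (X j) -
      (1/2) *\<^sub>R endo P (bracket (X i) (X j))"
    by (simp add: nabla_endo_def PX D_scaleR_right D_X X_smooth endo_scaleR[OF P] bracket_smooth)
  also have "\<dots> = (\<Sum>k\<in>UNIV. (C i j k * (sg j - sg k) / 2) *\<^sub>R X k)"
    unfolding endo_bracket_X[OF P PX]
    by (simp add: bracket_X scaleR_sum_right flip: sum_subtractf scaleR_left_diff_distrib)
      (simp add: field_simps)
  finally show ?thesis .
qed

lemma nijenhuis_X:
  assumes P: "almost_product A P" and PX: "\<And>i. endo P (X i) = sg i *\<^sub>R X i"
  shows "nijenhuis P (X i) (X j) =
    (\<Sum>k\<in>UNIV. (C i j k * (1 + (sg i + sg j) * sg k - sg i * sg j)) *\<^sub>R X k)"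
  by (simp add: nijenhuis_def PX bilinear_bracket X_smooth vf_simps bracket_smooth
      endo_scaleR[OF P] endo_bracket_X[OF P PX])
    (simp add: bracket_X scaleR_sum_right algebra_simps flip: sum.distrib sum_subtractf)

lemma ip_sum_sum:
  "ip g (\<Sum>k\<in>UNIV. c k *\<^sub>R X k) (\<Sum>k\<in>UNIV. c k *\<^sub>R X k) p = (\<Sum>k\<in>UNIV. eps k * (c k)\<^sup>2)"
proof -
  have s: "smooth_vf A (\<Sum>k\<in>UNIV. c k *\<^sub>R X k)" by (intro smooth_vf_sum vf_simps X_smooth)
  have "ip g (\<Sum>k\<in>UNIV. c k *\<^sub>R X k) (\<Sum>k\<in>UNIV. c k *\<^sub>R X k) p =
      (\<Sum>k\<in>UNIV. c k * ip g (X k) (\<Sum>k\<in>UNIV. c k *\<^sub>R X k) p)"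
    by (rule ip_sum_left[OF s X_smooth])
  then show ?thesis
    by (simp add: ip_sym[OF X_smooth s] ip_sum_X power2_eq_square mult_ac)
qed

end

subsection \<open>The structure constants\<close>

definition eps4 :: "4 \<Rightarrow> real" where
  "eps4 i = (if i = 1 \<or> i = 2 then 1 else -1)"

text \<open>For distinct \<open>a\<close>, \<open>b\<close>, \<open>c\<close>: the wedge product of
  three dual basis forms, evaluated on basis vectors.\<close>

definition wedge3 :: "'i \<Rightarrow> 'i \<Rightarrow> 'i \<Rightarrow> 'i \<Rightarrow> 'i \<Rightarrow> 'i \<Rightarrow> real" where
  "wedge3 a b c i j k =
    (if (i, j, k) \<in> {(a, b, c), (b, c, a), (c, a, b)} then 1
     else if (i, j, k) \<in> {(b, a, c), (a, c, b), (c, b, a)} then - 1 else 0)"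

text \<open>The 3-form \<open>g([x, y], z)\<close> with its last index raised.\<close>

definition str4 :: "real \<Rightarrow> real \<Rightarrow> real \<Rightarrow> real \<Rightarrow> 4 \<Rightarrow> 4 \<Rightarrow> 4 \<Rightarrow> real" where
  "str4 l1 l2 l3 l4 i j k = eps4 k *
    (l1 * wedge3 1 2 4 i j k - l2 * wedge3 1 2 3 i j k + l3 * wedge3 2 3 4 i j k - l4 * wedge3 1 3 4 i j k)"

lemma eps4_simps [simp]: "eps4 1 = 1" "eps4 2 = 1" "eps4 3 = -1" "eps4 4 = -1"
  by (simp_all add: eps4_def)

lemma str4_swap: "str4 l1 l2 l3 l4 j i k = - str4 l1 l2 l3 l4 i j k"
proof -
  have "\<forall>i j k. str4 l1 l2 l3 l4 j i k = - str4 l1 l2 l3 l4 i j k"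
    unfolding forall_4 by (simp add: str4_def wedge3_def)
  then show ?thesis by blast
qed

lemma str4_skew: "str4 l1 l2 l3 l4 i j k * eps4 k = - (str4 l1 l2 l3 l4 i k j * eps4 j)"
proof -
  have "\<forall>i j k. str4 l1 l2 l3 l4 i j k * eps4 k = - (str4 l1 l2 l3 l4 i k j * eps4 j)"
    unfolding forall_4 by (simp add: str4_def wedge3_def)
  then show ?thesis by blast
qed

lemma str4_diag [simp]: "str4 l1 l2 l3 l4 i i k = 0"
  using str4_swap[of l1 l2 l3 l4 i i k] by simp

text \<open>Once the first two indices are numerals, sums over the last one evaluate without
  unfolding \<open>wedge3\<close>.\<close>

lemma str4_upper [simp]:
  "str4 l1 l2 l3 l4 1 2 k = (if k = 3 then l2 else if k = 4 then - l1 else 0)"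
  "str4 l1 l2 l3 l4 1 3 k = (if k = 2 then l2 else if k = 4 then l4 else 0)"
  "str4 l1 l2 l3 l4 1 4 k = (if k = 2 then - l1 else if k = 3 then - l4 else 0)"
  "str4 l1 l2 l3 l4 2 3 k = (if k = 1 then - l2 else if k = 4 then - l3 else 0)"
  "str4 l1 l2 l3 l4 2 4 k = (if k = 1 then l1 else if k = 3 then l3 else 0)"
  "str4 l1 l2 l3 l4 3 4 k = (if k = 1 then - l4 else if k = 2 then l3 else 0)"
  using exhaust_4[of k] by (auto simp: str4_def wedge3_def)

lemma str4_lower [simp]:
  "str4 l1 l2 l3 l4 2 1 k = (if k = 3 then - l2 else if k = 4 then l1 else 0)"
  "str4 l1 l2 l3 l4 3 1 k = (if k = 2 then - l2 else if k = 4 then - l4 else 0)"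
  "str4 l1 l2 l3 l4 4 1 k = (if k = 2 then l1 else if k = 3 then l4 else 0)"
  "str4 l1 l2 l3 l4 3 2 k = (if k = 1 then l2 else if k = 4 then l3 else 0)"
  "str4 l1 l2 l3 l4 4 2 k = (if k = 1 then - l1 else if k = 3 then - l3 else 0)"
  "str4 l1 l2 l3 l4 4 3 k = (if k = 1 then l4 else if k = 2 then - l3 else 0)"
  by (subst str4_swap, simp)+

section \<open>Curvature and Ricci components as polynomials, free of points and fields\<close>

definition R4 :: "real \<Rightarrow> real \<Rightarrow> real \<Rightarrow> real \<Rightarrow> 4 \<Rightarrow> 4 \<Rightarrow> 4 \<Rightarrow> 4 \<Rightarrow> real" where
  "R4 l1 l2 l3 l4 i j k s =
    -1/4 * (\<Sum>m\<in>UNIV. str4 l1 l2 l3 l4 i j m * str4 l1 l2 l3 l4 k s m * eps4 m)"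

definition Ric4 :: "real \<Rightarrow> real \<Rightarrow> real \<Rightarrow> real \<Rightarrow> 4 \<Rightarrow> 4 \<Rightarrow> real" where
  "Ric4 l1 l2 l3 l4 j k = (\<Sum>i\<in>UNIV. eps4 i * R4 l1 l2 l3 l4 i j k i)"

lemma R4_sym: "R4 l1 l2 l3 l4 k s i j = R4 l1 l2 l3 l4 i j k s"
  by (simp add: R4_def mult_ac)

lemma R4_skew:
  "R4 l1 l2 l3 l4 j i k s = - R4 l1 l2 l3 l4 i j k s"
  "R4 l1 l2 l3 l4 i j s k = - R4 l1 l2 l3 l4 i j k s"
  by (simp_all add: R4_def str4_swap[of _ _ _ _ j i] str4_swap[of _ _ _ _ s k] sum_negf)

lemma R4_simps:
  "R4 l1 l2 l3 l4 1 2 2 1 = -1/4 * (l1\<^sup>2 + l2\<^sup>2)" "R4 l1 l2 l3 l4 1 3 3 1 = 1/4 * (l2\<^sup>2 - l4\<^sup>2)"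
  "R4 l1 l2 l3 l4 1 4 4 1 = 1/4 * (l1\<^sup>2 - l4\<^sup>2)" "R4 l1 l2 l3 l4 2 3 3 2 = 1/4 * (l2\<^sup>2 - l3\<^sup>2)"
  "R4 l1 l2 l3 l4 2 4 4 2 = 1/4 * (l1\<^sup>2 - l3\<^sup>2)" "R4 l1 l2 l3 l4 3 4 4 3 = 1/4 * (l3\<^sup>2 + l4\<^sup>2)"
  "R4 l1 l2 l3 l4 1 3 4 1 = - 1/4 * l1 * l2" "R4 l1 l2 l3 l4 2 3 4 2 = - 1/4 * l1 * l2"
  "R4 l1 l2 l3 l4 2 1 3 2 = 1/4 * l1 * l3" "R4 l1 l2 l3 l4 4 1 3 4 = - 1/4 * l1 * l3"
  "R4 l1 l2 l3 l4 1 2 3 1 = 1/4 * l1 * l4" "R4 l1 l2 l3 l4 4 2 3 4 = - 1/4 * l1 * l4"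
  "R4 l1 l2 l3 l4 2 1 4 2 = 1/4 * l2 * l3" "R4 l1 l2 l3 l4 3 1 4 3 = - 1/4 * l2 * l3"
  "R4 l1 l2 l3 l4 1 2 4 1 = 1/4 * l2 * l4" "R4 l1 l2 l3 l4 3 2 4 3 = - 1/4 * l2 * l4"
  "R4 l1 l2 l3 l4 3 1 2 3 = 1/4 * l3 * l4" "R4 l1 l2 l3 l4 4 1 2 4 = 1/4 * l3 * l4"
  by (simp_all add: R4_def sum_4 power2_eq_square algebra_simps)

lemma Ric4_sym: "Ric4 l1 l2 l3 l4 j k = Ric4 l1 l2 l3 l4 k j"
  unfolding Ric4_def
  by (rule sum.cong[OF refl]) (metis R4_sym R4_skew)

text \<open>These are the components of \<open>1/2 (g(v, v) g - w w)\<close>, where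
  \<open>v = (l3, l4, l1, l2)\<close> and \<open>w = (l3, l4, -l1, -l2)\<close> is its covector. The
  trace is \<open>3/2 g(v, v)\<close>.\<close>

lemma Ric4_simps:
  "Ric4 l1 l2 l3 l4 1 1 = -1/2 * (l1\<^sup>2 + l2\<^sup>2 - l4\<^sup>2)"
  "Ric4 l1 l2 l3 l4 2 2 = -1/2 * (l1\<^sup>2 + l2\<^sup>2 - l3\<^sup>2)"
  "Ric4 l1 l2 l3 l4 3 3 = 1/2 * (l2\<^sup>2 - l3\<^sup>2 - l4\<^sup>2)"
  "Ric4 l1 l2 l3 l4 4 4 = 1/2 * (l1\<^sup>2 - l3\<^sup>2 - l4\<^sup>2)"
  "Ric4 l1 l2 l3 l4 1 2 = -1/2 * l3 * l4" "Ric4 l1 l2 l3 l4 1 3 = 1/2 * l1 * l3"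
  "Ric4 l1 l2 l3 l4 1 4 = 1/2 * l2 * l3" "Ric4 l1 l2 l3 l4 2 3 = 1/2 * l1 * l4"
  "Ric4 l1 l2 l3 l4 2 4 = 1/2 * l2 * l4" "Ric4 l1 l2 l3 l4 3 4 = -1/2 * l1 * l2"
  by (simp_all add: Ric4_def R4_def sum_4 power2_eq_square algebra_simps)

text \<open>The product of two brackets \<open>[x, y]\<close> and \<open>[z, w]\<close> is the Gram
  determinant of \<open>x, y, v\<close> against \<open>z, w, v\<close>, with
  \<open>v = (l3, l4, l1, l2)\<close>. Expanded, it is a Kulkarni-Nomizu product of \<open>g\<close>
  with a symmetric form, hence has no Weyl part. The proof checks components.\<close>

lemma R4_weyl:
  fixes l1 l2 l3 l4 :: real
  defines "G \<equiv> \<lambda>i j :: 4. if i = j then eps4 i else 0" and "\<rho> \<equiv> Ric4 l1 l2 l3 l4"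
  shows "R4 l1 l2 l3 l4 i j k s = 1/2 *
    (G j k * \<rho> i s - G i k * \<rho> j s + \<rho> j k * G i s - \<rho> i k * G j s -
      (\<Sum>m\<in>UNIV. eps4 m * \<rho> m m) / 3 * (G j k * G i s - G i k * G j s))"
proof -
  define t where "t = (\<Sum>m\<in>UNIV. eps4 m * \<rho> m m) / 3"
  have t: "t = - 1/2 * (l1\<^sup>2 + l2\<^sup>2 - l3\<^sup>2 - l4\<^sup>2)"
    by (simp add: t_def \<rho>_def sum_4 Ric4_simps field_simps)
  define W where "W i j k s = R4 l1 l2 l3 l4 i j k s - 1/2 *
    (G j k * \<rho> i s - G i k * \<rho> j s + \<rho> j k * G i s - \<rho> i k * G j s -
      t * (G j k * G i s - G i k * G j s))" for i j k s
  have rho: "\<rho> 1 1 = -1/2 * (l1\<^sup>2 + l2\<^sup>2 - l4\<^sup>2)" "\<rho> 2 2 = -1/2 * (l1\<^sup>2 + l2\<^sup>2 - l3\<^sup>2)"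
    "\<rho> 3 3 = 1/2 * (l2\<^sup>2 - l3\<^sup>2 - l4\<^sup>2)" "\<rho> 4 4 = 1/2 * (l1\<^sup>2 - l3\<^sup>2 - l4\<^sup>2)"
    "\<rho> 1 2 = -1/2 * l3 * l4" "\<rho> 1 3 = 1/2 * l1 * l3" "\<rho> 1 4 = 1/2 * l2 * l3"
    "\<rho> 2 3 = 1/2 * l1 * l4" "\<rho> 2 4 = 1/2 * l2 * l4" "\<rho> 3 4 = -1/2 * l1 * l2"
    "\<rho> 2 1 = -1/2 * l3 * l4" "\<rho> 3 1 = 1/2 * l1 * l3" "\<rho> 4 1 = 1/2 * l2 * l3"
    "\<rho> 3 2 = 1/2 * l1 * l4" "\<rho> 4 2 = 1/2 * l2 * l4" "\<rho> 4 3 = -1/2 * l1 * l2"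
    by (simp_all add: \<rho>_def Ric4_simps Ric4_sym[of _ _ _ _ 2 1] Ric4_sym[of _ _ _ _ 3 1]
        Ric4_sym[of _ _ _ _ 4 1] Ric4_sym[of _ _ _ _ 3 2] Ric4_sym[of _ _ _ _ 4 2]
        Ric4_sym[of _ _ _ _ 4 3])
  \<comment> \<open>Skewness in both pairs leaves the 36 components with increasing pairs.\<close>
  have swap: "W j i k s = - W i j k s" "W i j s k = - W i j k s" for i j k s
    unfolding W_def R4_skew(1)[of _ _ _ _ j i k s] R4_skew(2)[of _ _ _ _ i j s k]
    by (simp_all add: algebra_simps)
  have diag: "W i i k s = 0" "W i j k k = 0" for i j k s
    using swap(1)[of i i k s] swap(2)[of i j k k] by auto
  have upper: "W 1 2 1 2 = 0" "W 1 2 1 3 = 0" "W 1 2 1 4 = 0" "W 1 2 2 3 = 0" "W 1 2 2 4 = 0" "W 1 2 3 4 = 0"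
    "W 1 3 1 2 = 0" "W 1 3 1 3 = 0" "W 1 3 1 4 = 0" "W 1 3 2 3 = 0" "W 1 3 2 4 = 0" "W 1 3 3 4 = 0"
    "W 1 4 1 2 = 0" "W 1 4 1 3 = 0" "W 1 4 1 4 = 0" "W 1 4 2 3 = 0" "W 1 4 2 4 = 0" "W 1 4 3 4 = 0"
    "W 2 3 1 2 = 0" "W 2 3 1 3 = 0" "W 2 3 1 4 = 0" "W 2 3 2 3 = 0" "W 2 3 2 4 = 0" "W 2 3 3 4 = 0"
    "W 2 4 1 2 = 0" "W 2 4 1 3 = 0" "W 2 4 1 4 = 0" "W 2 4 2 3 = 0" "W 2 4 2 4 = 0" "W 2 4 3 4 = 0"
    "W 3 4 1 2 = 0" "W 3 4 1 3 = 0" "W 3 4 1 4 = 0" "W 3 4 2 3 = 0" "W 3 4 2 4 = 0" "W 3 4 3 4 = 0"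
    by (simp_all add: W_def G_def rho t R4_def sum_4 power2_eq_square) (simp_all add: field_simps)?
  have upper': "W 1 2 k s = 0" "W 1 3 k s = 0" "W 1 4 k s = 0" "W 2 3 k s = 0" "W 2 4 k s = 0" "W 3 4 k s = 0" for k s
    using exhaust_4[of k] exhaust_4[of s] swap(2)[of _ _ 2 1] swap(2)[of _ _ 3 1]
      swap(2)[of _ _ 4 1] swap(2)[of _ _ 3 2] swap(2)[of _ _ 4 2] swap(2)[of _ _ 4 3]
    by (auto simp: upper diag)
  have "W i j k s = 0"
    using exhaust_4[of i] exhaust_4[of j] swap(1)[of 2 1] swap(1)[of 3 1]
      swap(1)[of 4 1] swap(1)[of 3 2] swap(1)[of 4 2] swap(1)[of 4 3]
    by (auto simp: upper' diag)
  then show ?thesis by (simp add: W_def t_def)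
qed

text \<open>The eight arrangements are the full orbit under the symmetries of a curvature tensor, so
  membership in the closure becomes a check in the finite list.\<close>

lemma R_closure_symmetries:
  assumes "(i, j, k, s) \<in> L \<or> (j, i, k, s) \<in> L \<or> (i, j, s, k) \<in> L \<or> (j, i, s, k) \<in> L \<or>
    (k, s, i, j) \<in> L \<or> (s, k, i, j) \<in> L \<or> (k, s, j, i) \<in> L \<or> (s, k, j, i) \<in> L"
  shows "(i, j, k, s) \<in> R_closure L"
proof -
  have skew: "(i, j, k, s) \<in> R_closure L" if "(j, i, k, s) \<in> R_closure L" for i j k s
    using R_closure.intros(3)[OF that] .
  have skew': "(i, j, k, s) \<in> R_closure L" if "(i, j, s, k) \<in> R_closure L" for i j k s
    using R_closure.intros(4)[OF that] .
  have 1: "(i, j, k, s) \<in> R_closure L" if "(i, j, k, s) \<in> L \<or> (k, s, i, j) \<in> L" for i j k s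
    using that R_closure.intros(1)[of i j k s L] R_closure.intros(1)[of k s i j L] R_closure.intros(2)[of k s i j L]
    by (elim disjE) simp_all
  from assms have "(i, j, k, s) \<in> R_closure L \<or> (j, i, k, s) \<in> R_closure L \<or>
      (i, j, s, k) \<in> R_closure L \<or> (j, i, s, k) \<in> R_closure L"
    using 1[of i j k s] 1[of j i k s] 1[of i j s k] 1[of j i s k] by argo
  then show ?thesis
    using skew[of j i k s] skew'[of i j s k] skew'[of j i s k] by argo
qed

lemma R4_support:
  assumes "(i, j, k, s) \<notin> R_closure
    {(1,2,2,1), (1,3,3,1), (1,4,4,1), (2,3,3,2), (2,4,4,2), (3,4,4,3),
     (1,3,4,1), (2,3,4,2), (2,1,3,2), (4,1,3,4), (1,2,3,1), (4,2,3,4),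
     (2,1,4,2), (3,1,4,3), (1,2,4,1), (3,2,4,3), (3,1,2,3), (4,1,2,4)}" (is "_ \<notin> R_closure ?L")
  shows "R4 l1 l2 l3 l4 i j k s = 0"
proof -
  define L :: "(4 \<times> 4 \<times> 4 \<times> 4) set" where "L = ?L"
  \<comment> \<open>Being listed or zero is invariant under both index swaps, so the 36 increasing
    pairs suffice again.\<close>
  define Z where "Z i j k s \<longleftrightarrow> (i, j, k, s) \<in> R_closure L \<or> R4 l1 l2 l3 l4 i j k s = 0" for i j k s
  have "(j, i, k, s) \<in> R_closure L \<longleftrightarrow> (i, j, k, s) \<in> R_closure L" for i j k s
    by (rule iffI; rule R_closure.intros(3))
  then have Z_iff1: "Z j i k s \<longleftrightarrow> Z i j k s" for i j k s
    unfolding Z_def R4_skew(1)[of l1 l2 l3 l4 j i k s] by (simp only: neg_equal_0_iff_equal)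
  have "(i, j, s, k) \<in> R_closure L \<longleftrightarrow> (i, j, k, s) \<in> R_closure L" for i j k s
    by (rule iffI; rule R_closure.intros(4))
  then have Z_iff2: "Z i j s k \<longleftrightarrow> Z i j k s" for i j k s
    unfolding Z_def R4_skew(2)[of l1 l2 l3 l4 i j s k] by (simp only: neg_equal_0_iff_equal)
  have diag: "Z i i k s" "Z i j k k" for i j k s
    by (simp_all add: Z_def R4_def)
  have ZI: "Z i j k s" if "R4 l1 l2 l3 l4 i j k s = 0 \<or>
    ((i, j, k, s) \<in> L \<or> (j, i, k, s) \<in> L \<or> (i, j, s, k) \<in> L \<or> (j, i, s, k) \<in> L \<or>
    (k, s, i, j) \<in> L \<or> (s, k, i, j) \<in> L \<or> (k, s, j, i) \<in> L \<or> (s, k, j, i) \<in> L)" for i j k s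
    using that R_closure_symmetries[of i j k s L] unfolding Z_def by blast
  have upper: "Z 1 2 1 2" "Z 1 2 1 3" "Z 1 2 1 4" "Z 1 2 2 3" "Z 1 2 2 4" "Z 1 2 3 4"
    "Z 1 3 1 2" "Z 1 3 1 3" "Z 1 3 1 4" "Z 1 3 2 3" "Z 1 3 2 4" "Z 1 3 3 4"
    "Z 1 4 1 2" "Z 1 4 1 3" "Z 1 4 1 4" "Z 1 4 2 3" "Z 1 4 2 4" "Z 1 4 3 4"
    "Z 2 3 1 2" "Z 2 3 1 3" "Z 2 3 1 4" "Z 2 3 2 3" "Z 2 3 2 4" "Z 2 3 3 4"
    "Z 2 4 1 2" "Z 2 4 1 3" "Z 2 4 1 4" "Z 2 4 2 3" "Z 2 4 2 4" "Z 2 4 3 4"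
    "Z 3 4 1 2" "Z 3 4 1 3" "Z 3 4 1 4" "Z 3 4 2 3" "Z 3 4 2 4" "Z 3 4 3 4"
    by (rule ZI, simp add: R4_def sum_4 L_def)+
  have upper': "Z 1 2 k s" "Z 1 3 k s" "Z 1 4 k s" "Z 2 3 k s" "Z 2 4 k s" "Z 3 4 k s" for k s
    using exhaust_4[of k] exhaust_4[of s] Z_iff2[of _ _ 2 1] Z_iff2[of _ _ 3 1]
      Z_iff2[of _ _ 4 1] Z_iff2[of _ _ 3 2] Z_iff2[of _ _ 4 2] Z_iff2[of _ _ 4 3]
    by (auto simp: upper diag)
  have "Z i j k s"
    using exhaust_4[of i] exhaust_4[of j] Z_iff1[of 2 1] Z_iff1[of 3 1]
      Z_iff1[of 4 1] Z_iff1[of 3 2] Z_iff1[of 4 2] Z_iff1[of 4 3]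
    by (auto simp: upper' diag)
  with assms show ?thesis by (simp add: Z_def L_def)
qed

theorem theorem4p2:
  fixes A :: "('g::{t2_space,second_countable_topology}, real^4) atlas"
    and mul :: "'g \<Rightarrow> 'g \<Rightarrow> 'g" and e :: 'g and iv :: "'g \<Rightarrow> 'g"
    and X :: "4 \<Rightarrow> 'g vfield"
    and g :: "'g metric_field" and P :: "'g endo_field" and D :: "'g connection"
    and l1 l2 l3 l4 :: real
  assumes G: "lie_group A mul e iv" and conn: "connected (UNIV :: 'g set)"
    and X_linv: "\<And>i. left_invariant_vf A mul (X i)"
    and X_basis: "\<And>p. frame_at A X p"
    and b12: "bracket (X 1) (X 2) = l2 *\<^sub>R X 3 - l1 *\<^sub>R X 4"
    and b13: "bracket (X 1) (X 3) = l2 *\<^sub>R X 2 + l4 *\<^sub>R X 4"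
    and b14: "bracket (X 1) (X 4) = - l1 *\<^sub>R X 2 - l4 *\<^sub>R X 3"
    and b23: "bracket (X 2) (X 3) = - l2 *\<^sub>R X 1 - l3 *\<^sub>R X 4"
    and b24: "bracket (X 2) (X 4) = l1 *\<^sub>R X 1 + l3 *\<^sub>R X 3"
    and b34: "bracket (X 3) (X 4) = - l4 *\<^sub>R X 1 + l3 *\<^sub>R X 2"
    and g: "pseudo_riemannian A g" "left_invariant_metric A mul g"
    and g_diag: "\<And>p. ip g (X 1) (X 1) p = 1" "\<And>p. ip g (X 2) (X 2) p = 1"
      "\<And>p. ip g (X 3) (X 3) p = -1" "\<And>p. ip g (X 4) (X 4) p = -1"
    and g_off: "\<And>i j p. i \<noteq> j \<Longrightarrow> ip g (X i) (X j) p = 0"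
    and P: "almost_product A P" "left_invariant_endo A mul P"
    and P_X: "endo P (X 1) = X 1" "endo P (X 2) = X 2"
      "endo P (X 3) = - X 3" "endo P (X 4) = - X 4"
    and D: "levi_civita A g D"
  shows
    "(locally_symmetric A D \<and> conformally_flat4 A g D \<and> W3_manifold A g D P \<and> killing_metric A mul g)
     \<and>
     (\<forall>p. let F = (\<lambda>i j k. F_tensor g D P (X i) (X j) (X k) p) in
        F 1 2 4 = l1 \<and> F 2 1 4 = - l1 \<and> F 2 1 3 = l2 \<and> F 1 2 3 = - l2 \<and>
        F 4 2 3 = l3 \<and> F 3 2 4 = - l3 \<and> F 3 1 4 = l4 \<and> F 4 1 3 = - l4 \<and>
        (\<forall>i j k. F i j k = F i k j) \<and>
        (\<forall>i j k. (i, j, k) \<notin> F_closure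
             {(1,2,4), (2,1,4), (2,1,3), (1,2,3), (4,2,3), (3,2,4), (3,1,4), (4,1,3)}
           \<longrightarrow> F i j k = 0))
     \<and>
     (\<forall>p. let R = (\<lambda>i j k s. Rm g D (X i) (X j) (X k) (X s) p) in
        R 1 2 2 1 = - 1/4 * (l1^2 + l2^2) \<and> R 1 3 3 1 = 1/4 * (l2^2 - l4^2) \<and>
        R 1 4 4 1 = 1/4 * (l1^2 - l4^2) \<and> R 2 3 3 2 = 1/4 * (l2^2 - l3^2) \<and>
        R 2 4 4 2 = 1/4 * (l1^2 - l3^2) \<and> R 3 4 4 3 = 1/4 * (l3^2 + l4^2) \<and>
        R 1 3 4 1 = - 1/4 * l1 * l2 \<and> R 2 3 4 2 = - 1/4 * l1 * l2 \<and>
        R 2 1 3 2 = 1/4 * l1 * l3 \<and> R 4 1 3 4 = - 1/4 * l1 * l3 \<and>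
        R 1 2 3 1 = 1/4 * l1 * l4 \<and> R 4 2 3 4 = - 1/4 * l1 * l4 \<and>
        R 2 1 4 2 = 1/4 * l2 * l3 \<and> R 3 1 4 3 = - 1/4 * l2 * l3 \<and>
        R 1 2 4 1 = 1/4 * l2 * l4 \<and> R 3 2 4 3 = - 1/4 * l2 * l4 \<and>
        R 3 1 2 3 = 1/4 * l3 * l4 \<and> R 4 1 2 4 = 1/4 * l3 * l4 \<and>
        (\<forall>i j k s. R i j k s = R k s i j \<and> R i j k s = - R j i k s \<and> R i j k s = - R i j s k) \<and>
        (\<forall>i j k s. (i, j, k, s) \<notin> R_closure
             {(1,2,2,1), (1,3,3,1), (1,4,4,1), (2,3,3,2), (2,4,4,2), (3,4,4,3),
              (1,3,4,1), (2,3,4,2), (2,1,3,2), (4,1,3,4), (1,2,3,1), (4,2,3,4),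
              (2,1,4,2), (3,1,4,3), (1,2,4,1), (3,2,4,3), (3,1,2,3), (4,1,2,4)}
           \<longrightarrow> R i j k s = 0))
     \<and>
     (\<forall>p E. frame_at A (E :: 4 \<Rightarrow> 'g vfield) p \<longrightarrow> (let \<rho> = (\<lambda>i j. ricci g D E (X i) (X j) p) in
        \<rho> 1 1 = - 1/2 * (l1^2 + l2^2 - l4^2) \<and> \<rho> 2 2 = - 1/2 * (l1^2 + l2^2 - l3^2) \<and>
        \<rho> 3 3 = 1/2 * (l2^2 - l3^2 - l4^2) \<and> \<rho> 4 4 = 1/2 * (l1^2 - l3^2 - l4^2) \<and>
        \<rho> 1 2 = - 1/2 * l3 * l4 \<and> \<rho> 1 3 = 1/2 * l1 * l3 \<and> \<rho> 1 4 = 1/2 * l2 * l3 \<and>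
        \<rho> 2 3 = 1/2 * l1 * l4 \<and> \<rho> 2 4 = 1/2 * l2 * l4 \<and> \<rho> 3 4 = - 1/2 * l1 * l2 \<and>
        (\<forall>i j. \<rho> i j = \<rho> j i)))
     \<and>
     (\<forall>p. nijenhuis_sqnorm g P X p = -24 * (l1^2 + l2^2 - l3^2 - l4^2))
     \<and>
     (\<forall>p E. frame_at A (E :: 4 \<Rightarrow> 'g vfield) p \<longrightarrow>
        nablaP_sqnorm g D P E p = -4 * (l1^2 + l2^2 - l3^2 - l4^2))
     \<and>
     (\<forall>p E. frame_at A (E :: 4 \<Rightarrow> 'g vfield) p \<longrightarrow>
        scalar_curv g D E p = - 3/2 * (l1^2 + l2^2 - l3^2 - l4^2))
     \<and>
     (\<forall>p. let k = (\<lambda>i j. sectional_curv g D (X i) (X j) p) in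
        k 1 3 = - 1/4 * (l2^2 - l4^2) \<and> k 2 4 = - 1/4 * (l1^2 - l3^2) \<and>
        k 1 2 = - 1/4 * (l1^2 + l2^2) \<and> k 1 4 = - 1/4 * (l1^2 - l4^2) \<and>
        k 2 3 = - 1/4 * (l2^2 - l3^2) \<and> k 3 4 = 1/4 * (l3^2 + l4^2))"
proof -
  let ?C = "str4 l1 l2 l3 l4" and ?R = "R4 l1 l2 l3 l4" and ?q = "l1^2 + l2^2 - l3^2 - l4^2"
  have atlas: "smooth_atlas A" and grp: "group mul e iv"
    using G by (auto simp: lie_group_def)
  have Xs: "smooth_vf A (X i)" for i
    using X_linv by (simp add: left_invariant_vf_def)
  have brackets: "bracket (X i) (X j) = (\<Sum>k\<in>UNIV. ?C i j k *\<^sub>R X k)" for i j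
  proof -
    have z: "bracket (X i) (X i) = 0" for i
      by (simp add: bracket_def zero_fun_def)
    show ?thesis
      using exhaust_4[of i] exhaust_4[of j]
      by (elim disjE)
        (simp_all add: sum_4 z b12 b13 b14 b23 b24 b34 bracket_swap[of "X 2" "X 1"]
          bracket_swap[of "X 3" "X 1"] bracket_swap[of "X 4" "X 1"] bracket_swap[of "X 3" "X 2"]
          bracket_swap[of "X 4" "X 2"] bracket_swap[of "X 4" "X 3"])
  qed
  interpret biinvariant_frame A g D X eps4 ?C
  proof
    show "ip g (X i) (X j) p = (if i = j then eps4 i else 0)" for i j p
      using exhaust_4[of i] g_diag g_off by auto
    show "eps4 i * eps4 i = 1" for i by (simp add: eps4_def)
  qed (fact atlas g(1) D X_basis brackets str4_skew)+
  \<comment> \<open>The eigenvalues of \<open>P\<close> coincide with the signs of the metric, so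
    \<open>eps4\<close> plays both roles.\<close>
  have PX: "endo P (X i) = eps4 i *\<^sub>R X i" for i
    using exhaust_4[of i] P_X by auto
  have F: "F_tensor g D P (X i) (X j) (X k) p = ?C i j k * (eps4 j - eps4 k) / 2 * eps4 k" for i j k p
    by (simp add: F_tensor_def nabla_endo_X[OF P(1) PX] ip_sum_X)
  have R: "Rm g D (X i) (X j) (X k) (X s) p = ?R i j k s" for i j k s p
    by (simp add: Rm_X R4_def)
  have ric: "ricci g D E (X i) (X j) p = Ric4 l1 l2 l3 l4 i j" if "frame_at A E p" for i j p and E :: "4 \<Rightarrow> 'g vfield"
    by (simp add: ricci_trace[OF that] X_smooth R Ric4_def)
  have scal: "scalar_curv g D E p = (\<Sum>k\<in>UNIV. eps4 k * Ric4 l1 l2 l3 l4 k k)"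
    if "frame_at A E p" for p and E :: "4 \<Rightarrow> 'g vfield"
    by (simp add: scalar_trace[OF that] ric[OF that])

  have flat: "conformally_flat4 A g D"
    unfolding conformally_flat4_def
  proof (intro allI impI)
    fix p and E :: "4 \<Rightarrow> 'g vfield" and U V Y Z
    assume E: "frame_at A E p" and s: "smooth_vf A U" "smooth_vf A V" "smooth_vf A Y" "smooth_vf A Z"
    note t = tensorial_combine tensorial_mult tensorial_Rm tensorial_ricci[OF E] tensorial_ip X_smooth s
    \<comment> \<open>On the frame this is \<open>R4_weyl\<close>; the four slots are then freed one
      by one.\<close>
    have 0: "weyl4 g D E (X i) (X j) (X k) (X l) p = 0" for i j k l
      by (simp add: weyl4_def psi1_ricci_def pi1_def R R4_weyl ric[OF E] scal[OF E] orthonormal)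
    have 1: "weyl4 g D E U (X j) (X k) (X l) p = 0" for j k l
      by (rule tensorial_zero[where p = p and T = "\<lambda>U. weyl4 g D E U (X j) (X k) (X l) p", OF _ 0 s(1)])
        (unfold weyl4_def psi1_ricci_def pi1_def, intro t)
    have 2: "weyl4 g D E U V (X k) (X l) p = 0" for k l
      by (rule tensorial_zero[where p = p and T = "\<lambda>V. weyl4 g D E U V (X k) (X l) p", OF _ 1 s(2)])
        (unfold weyl4_def psi1_ricci_def pi1_def, intro t)
    have 3: "weyl4 g D E U V Y (X l) p = 0" for l
      by (rule tensorial_zero[where p = p and T = "\<lambda>Y. weyl4 g D E U V Y (X l) p", OF _ 2 s(3)])
        (unfold weyl4_def psi1_ricci_def pi1_def, intro t)
    show "weyl4 g D E U V Y Z p = 0"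
      by (rule tensorial_zero[where p = p and T = "\<lambda>Z. weyl4 g D E U V Y Z p", OF _ 3 s(4)])
        (unfold weyl4_def psi1_ricci_def pi1_def, intro t)
  qed
  have W3: "W3_manifold A g D P"
  proof (rule W3I[OF P(1)])
    fix i j k p
    \<comment> \<open>The lowered constants are invariant under cyclic shifts, so the three terms
      share one factor, and the shifts of \<open>(eps4 j - eps4 k) / 2\<close> add up to
      zero.\<close>
    have "?C j k i * eps4 i = ?C i j k * eps4 k" "?C k i j * eps4 j = ?C i j k * eps4 k"
      using str4_skew[of l1 l2 l3 l4 j k i] str4_skew[of l1 l2 l3 l4 i k j]
        str4_swap[of l1 l2 l3 l4 j i k] str4_swap[of l1 l2 l3 l4 k i j] by simp_all
    then have "?C j k i * (eps4 k - eps4 i) / 2 * eps4 i = (eps4 k - eps4 i) / 2 * (?C i j k * eps4 k)"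
      "?C k i j * (eps4 i - eps4 j) / 2 * eps4 j = (eps4 i - eps4 j) / 2 * (?C i j k * eps4 k)"
      by (metis mult.commute mult.assoc times_divide_eq_left)+
    then show "F_tensor g D P (X i) (X j) (X k) p + F_tensor g D P (X j) (X k) (X i) p +
        F_tensor g D P (X k) (X i) (X j) p = 0"
      unfolding F by (simp add: field_simps)
  qed

  have F_sym: "?C i j k * (eps4 j - eps4 k) / 2 * eps4 k = ?C i k j * (eps4 k - eps4 j) / 2 * eps4 j" for i j k
  proof -
    have "?C i j k * (eps4 j - eps4 k) / 2 * eps4 k = (eps4 j - eps4 k) / 2 * (?C i j k * eps4 k)"
      by simp
    also have "\<dots> = ?C i k j * (eps4 k - eps4 j) / 2 * eps4 j"
      unfolding str4_skew[of _ _ _ _ i j k] by (simp add: field_simps)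
    finally show ?thesis .
  qed
  have F_support: "?C i j k * (eps4 j - eps4 k) / 2 * eps4 k = 0" if "(i, j, k) \<notin> F_closure
      {(1,2,4), (2,1,4), (2,1,3), (1,2,3), (4,2,3), (3,2,4), (3,1,4), (4,1,3)}" (is "_ \<notin> F_closure ?L") for i j k
  proof -
    have "(i, j, k) \<notin> ?L" "(i, k, j) \<notin> ?L"
      by (rule contrapos_nn[OF that], rule F_closure.intros(1), assumption)
        (rule contrapos_nn[OF that], rule F_closure.intros(2), rule F_closure.intros(1), assumption)
    then show ?thesis
      using exhaust_4[of i] exhaust_4[of j] exhaust_4[of k] by (elim disjE) simp_all
  qed

  have N: "nijenhuis_sqnorm g P X p = -24 * ?q" for p
  proof -
    have "nijenhuis_sqnorm g P X p = (\<Sum>i\<in>UNIV. \<Sum>k\<in>UNIV. eps4 i * eps4 k *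
        ip g (nijenhuis P (X i) (X k)) (nijenhuis P (X i) (X k)) p)"
      by (simp only: nijenhuis_sqnorm_def ginv_X mult.assoc sum_distrib_left[symmetric] sum_delta_mult)
    \<comment> \<open>The factor in \<open>nijenhuis_X\<close> is always 2 or -2 here, so this is
      four times the square norm of the bracket. Each constant occurs in six ordered triples,
      weighted by the product of the three signs: -1 for \<open>l1\<close>, \<open>l2\<close> and 1
      for \<open>l3\<close>, \<open>l4\<close>.\<close>
    also have "\<dots> = -24 * ?q"
      unfolding nijenhuis_X[OF P(1) PX] ip_sum_sum
      by (simp add: sum_4 power2_eq_square)
    finally show ?thesis .
  qed
  \<comment> \<open>The square of \<open>(eps4 j - eps4 k) / 2\<close> is 1 if \<open>j\<close> and
    \<open>k\<close> belong to different eigenspaces and 0 otherwise. Four of the six orderings of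
    each triple survive, with the same weights as for \<open>nijenhuis\<close>.\<close>
  have nablaP: "nablaP_sqnorm g D P E p = -4 * ?q" if "frame_at A E p" for p and E :: "4 \<Rightarrow> 'g vfield"
    unfolding nablaP_trace[OF P(1) that] nabla_endo_X[OF P(1) PX] ip_sum_sum
    by (simp add: sum_4 power2_eq_square)
  have tau: "scalar_curv g D E p = - 3/2 * ?q" if "frame_at A E p" for p and E :: "4 \<Rightarrow> 'g vfield"
    by (simp add: scal[OF that] sum_4 Ric4_simps field_simps)
  \<comment> \<open>The denominator is \<open>eps4 a * eps4 b\<close>, a sign and so its own
    inverse.\<close>
  have sec: "sectional_curv g D (X a) (X b) p = ?R a b b a * (eps4 a * eps4 b)" if "a \<noteq> b" for a b p
    using that by (simp add: sectional_curv_def R pi1_def orthonormal) (simp add: eps4_def)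
  show ?thesis
    unfolding Let_def F R
    by (intro conjI allI impI;
        (rule locally_symmetric flat W3 killing[OF grp g(2) X_linv] F_sym N R4_sym R4_skew |
          (rule F_support R4_support nablaP tau, assumption) |
          (simp only: ric; rule Ric4_sym) |
          simp add: ric Ric4_simps sec R4_simps))
qed

end
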